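(* Let $X$ be an $\mathbb R^d$-valued random vector whose distribution $\mathbb P_X$ has compact support, and assume that $\operatorname{conv}(\operatorname{supp}\mathbb P_X)$ has nonempty interior in $\mathbb R^d$. (a) Let $p\in[1,+\infty)$. For every integer $n\ge d+1$, the $L^p$-mean dual quantization error function $\gamma\mapsto d_{n,p}(X,\gamma)$ is lower semi-continuous on $(\mathbb R^d)^n$ (with values in $[0,+\infty]$), and if $p>1$ it also attains a minimum. (b) Let $p>1$ and let $n\ge d+1$. If $|\operatorname{supp}\mathbb P_X|\ge n$, then any optimal grid $\Gamma^{n,*}$ at level $n$ has size exactly $n$; and $d_{n,p}(X)=0$ if and only if $|\operatorname{supp}\mathbb P_X|\le n$. Furthermore, the sequence $n\mapsto d_{n,p}(X)$ ($n\ge d+1$) decreases strictly to $0$ as long as it does not vanish.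
   Context: $\mathbb R^d$ carries a fixed norm $\|\cdot\|$; $\operatorname{supp}\mathbb P_X$ is the support of the distribution of $X$; $|A|$ is the cardinality of a set $A$. For $\gamma=(x_1,\dots,x_n)\in(\mathbb R^d)^n$ and $\xi\in\mathbb R^d$, $$F_{n,p}(\xi,\gamma)=\inf\Bigl\{\Bigl(\sum_{i=1}^n\lambda_i\|\xi-x_i\|^p\Bigr)^{1/p}:\ \lambda_i\in[0,1],\ \sum_{i=1}^n\lambda_i x_i=\xi,\ \sum_{i=1}^n\lambda_i=1\Bigr\}\quad(\inf\emptyset=+\infty),$$ $d_{n,p}(X,\gamma)=\|F_{n,p}(X,\gamma)\|_{L^p}=(\mathbb E\,F_{n,p}(X,\gamma)^p)^{1/p}$, and $d_{n,p}(X)=\inf\{d_{n,p}(X,\gamma):\gamma\in(\mathbb R^d)^n\}$. The value $F_{n,p}(\xi,\gamma)$ depends only on the value set $\Gamma_\gamma=\{x_1,\dots,x_n\}$. An optimal grid at level $n$ is a set $\Gamma_\gamma$ (of at most $n$ points) such that $d_{n,p}(X,\gamma)=d_{n,p}(X)$. *)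

theory Defs
  imports "HOL-Probability.Probability"
begin

text \<open>An arbitrary norm on a real vector space. On \<open>real ^ 'd\<close> it may differ from the
  Euclidean norm of the type; it induces the same topology and the same Borel sets.\<close>

definition is_norm :: "('a::real_vector \<Rightarrow> real) \<Rightarrow> bool" where
  "is_norm N \<longleftrightarrow> (\<forall>x. 0 \<le> N x) \<and> (\<forall>x. N x = 0 \<longleftrightarrow> x = 0)
     \<and> (\<forall>c x. N (c *\<^sub>R x) = \<bar>c\<bar> * N x) \<and> (\<forall>x y. N (x + y) \<le> N x + N y)"

definition measure_supp :: "'a::topological_space measure \<Rightarrow> 'a set" where
  "measure_supp \<mu> = {x. \<forall>U. open U \<longrightarrow> x \<in> U \<longrightarrow> emeasure \<mu> U > 0}"

text \<open>Powers on \<open>[0, \<infinity>]\<close>, meant for exponents \<open>r > 0\<close> only, so that \<open>\<infinity>\<close> is mapped to \<open>\<infinity>\<close>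
  and \<open>0\<close> to \<open>0\<close>.\<close>

definition ennreal_powr :: "ennreal \<Rightarrow> real \<Rightarrow> ennreal" where
  "ennreal_powr x r = (if x = \<infinity> then \<infinity> else ennreal (enn2real x powr r))"

text \<open>An \<open>n\<close>-tuple of vectors is a function in \<open>{..<n} \<rightarrow>\<^sub>E UNIV\<close>, i.e. indexed by \<open>0, \<dots>, n - 1\<close>
  and \<open>undefined\<close> elsewhere; \<open>tuple_top n\<close> has exactly these points.\<close>

definition tuple_top :: "nat \<Rightarrow> (nat \<Rightarrow> real ^ 'd) topology" where
  "tuple_top n = product_topology (\<lambda>_. euclidean) {..<n}"

definition lower_semicontinuous_map :: "'a topology \<Rightarrow> ('a \<Rightarrow> ennreal) \<Rightarrow> bool" where
  "lower_semicontinuous_map T f \<longleftrightarrow> (\<forall>a. openin T {x \<in> topspace T. a < f x})"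

text \<open>The local error \<open>F\<^bsub>n,p\<^esub>(\<xi>, \<gamma>)\<close> for the norm \<open>N\<close>. In \<^typ>\<open>ennreal\<close> the infimum of the empty
  set is \<open>\<infinity>\<close>.\<close>

definition dq_local ::
  "(real ^ 'd \<Rightarrow> real) \<Rightarrow> real \<Rightarrow> nat \<Rightarrow> real ^ 'd \<Rightarrow> (nat \<Rightarrow> real ^ 'd) \<Rightarrow> ennreal" where
  "dq_local N p n \<xi> \<gamma> =
     Inf {ennreal ((\<Sum>i<n. l i * N (\<xi> - \<gamma> i) powr p) powr (1 / p)) | l.
            (\<forall>i<n. 0 \<le> l i \<and> l i \<le> (1::real)) \<and> (\<Sum>i<n. l i *\<^sub>R \<gamma> i) = \<xi> \<and> (\<Sum>i<n. l i) = 1}"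

definition dq_error ::
  "(real ^ 'd \<Rightarrow> real) \<Rightarrow> real \<Rightarrow> 'w measure \<Rightarrow> ('w \<Rightarrow> real ^ 'd) \<Rightarrow> nat \<Rightarrow> (nat \<Rightarrow> real ^ 'd) \<Rightarrow> ennreal"
where
  "dq_error N p M X n \<gamma> =
     ennreal_powr (\<integral>\<^sup>+ \<omega>. ennreal_powr (dq_local N p n (X \<omega>) \<gamma>) p \<partial>M) (1 / p)"

definition dq_opt ::
  "(real ^ 'd \<Rightarrow> real) \<Rightarrow> real \<Rightarrow> 'w measure \<Rightarrow> ('w \<Rightarrow> real ^ 'd) \<Rightarrow> nat \<Rightarrow> ennreal" where
  "dq_opt N p M X n = (INF \<gamma> \<in> {..<n} \<rightarrow>\<^sub>E UNIV. dq_error N p M X n \<gamma>)"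

definition optimal_grid ::
  "(real ^ 'd \<Rightarrow> real) \<Rightarrow> real \<Rightarrow> 'w measure \<Rightarrow> ('w \<Rightarrow> real ^ 'd) \<Rightarrow> nat \<Rightarrow> (real ^ 'd) set \<Rightarrow> bool"
where
  "optimal_grid N p M X n \<Gamma> \<longleftrightarrow>
     (\<exists>\<gamma> \<in> {..<n} \<rightarrow>\<^sub>E UNIV. \<Gamma> = \<gamma> ` {..<n} \<and> dq_error N p M X n \<gamma> = dq_opt N p M X n)"

end

theory Submission
  imports Defs
begin

text \<open>Everything is expressed through the \<open>p\<close>-th power of the local error, a linear programme in the
  barycentric weights. Compactness of the weights makes it jointly lower semicontinuous in the point
  and the grid, and for \<open>p > 1\<close> this persists when grid points escape to infinity, which are then
  simply dropped; Fatou's lemma yields lower semicontinuity of the mean error and the existence of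
  optimal grids.
  Adding to a grid a point \<open>\<xi>0\<close> of the support that it lacks never increases the local error and
  strictly decreases it near \<open>\<xi>0\<close>, hence strictly decreases a finite mean error. Optimal grids
  therefore use all their points until they contain the support. Convergence to \<open>0\<close> comes from the
  union of a large simplex and a fine net of the support.\<close>

subsection \<open>Sequences and extended powers\<close>

text \<open>The two ranges of \<open>p\<close> come from one obstruction: a grid point at distance R
  with weight 1/R contributes R^(p-1) to the moment. For p = 1 this stays bounded although the point
  still shifts the barycentre by a fixed amount; for p > 1 a bounded moment forces the shift to
  vanish. The local cost is infinite outside the convex hull of the grid, so no continuity is
  available near \<xi>0. Strict improvement is therefore obtained by contradiction: without it the
  old and new costs agree almost surely, hence at points of finite cost converging to \<xi>0, and
  the limit of the optimal weights at these points is the weight vector that gets perturbed. The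
  bound d + 1 is the number of vertices of a simplex around the support. It makes the minimal mean
  cost finite, which every strict inequality between mean costs relies on. Index sets are arbitrary,
  so that tuples, grids indexed by their own points, and grids with escaped points dropped are all
  instances of one notion.\<close>

lemma finite_common_subseq:
  fixes Q :: "'i \<Rightarrow> (nat \<Rightarrow> nat) \<Rightarrow> bool"
  assumes "finite I"
    and ex: "\<And>i (r :: nat \<Rightarrow> nat). i \<in> I \<Longrightarrow> strict_mono r \<Longrightarrow> \<exists>s. strict_mono s \<and> Q i (r \<circ> s)"
    and sub: "\<And>i (r :: nat \<Rightarrow> nat) (s :: nat \<Rightarrow> nat). Q i r \<Longrightarrow> strict_mono s \<Longrightarrow> Q i (r \<circ> s)"
  shows "\<exists>r. strict_mono r \<and> (\<forall>i\<in>I. Q i r)"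
  using assms(1) ex
proof (induction I)
  case empty
  show ?case using strict_mono_id by blast
next
  case (insert a I)
  then obtain r where r: "strict_mono r" "\<forall>i\<in>I. Q i r" by (metis insertCI)
  obtain s where s: "strict_mono s" "Q a (r \<circ> s)" using insert.prems[of a r] r by blast
  then show ?case using r sub[OF _ s(1)] strict_mono_o[OF r(1) s(1)] by blast
qed

lemma LIMSEQ_imp_bounded_above:
  fixes f :: "nat \<Rightarrow> real"
  assumes "f \<longlonglongrightarrow> a"
  obtains B where "\<And>k. f k \<le> B"
proof -
  obtain B where "\<forall>k. norm (f k) \<le> B"
    using convergent_imp_Bseq[OF convergentI[OF assms]] unfolding Bseq_def by blast
  then have "f k \<le> B" for k using abs_le_D1[of "f k" B] by simp
  then show ?thesis using that by blast
qed

lemma ennreal_powr_inverse: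
  assumes "r > 0"
  shows "ennreal_powr (ennreal_powr x r) (1 / r) = x"
  using assms by (cases x rule: ennreal_cases) (simp_all add: ennreal_powr_def powr_powr)

lemma ennreal_powr_mono:
  assumes "r > 0" "x \<le> y"
  shows "ennreal_powr x r \<le> ennreal_powr y r"
  using assms by (cases x rule: ennreal_cases; cases y rule: ennreal_cases)
    (simp_all add: ennreal_powr_def top_unique ennreal_leI powr_mono2)

lemma ennreal_powr_le_iff:
  assumes "r > 0"
  shows "ennreal_powr x r \<le> ennreal_powr y r \<longleftrightarrow> x \<le> y"
  using ennreal_powr_mono[OF assms, of x y] ennreal_powr_mono[of "1 / r" "ennreal_powr x r" "ennreal_powr y r"]
  by (auto simp: ennreal_powr_inverse[OF assms] assms)

lemma ennreal_powr_eq_iff: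
  assumes "r > 0"
  shows "ennreal_powr x r = ennreal_powr y r \<longleftrightarrow> x = y"
  using ennreal_powr_le_iff[OF assms, of x y] ennreal_powr_le_iff[OF assms, of y x] by auto

lemma ennreal_powr_less_iff:
  assumes "r > 0"
  shows "ennreal_powr x r < ennreal_powr y r \<longleftrightarrow> x < y"
  using ennreal_powr_le_iff[OF assms] by (simp add: not_le [symmetric])

lemma ennreal_powr_root_le_iff:
  assumes "r > 0"
  shows "ennreal_powr x (1 / r) \<le> y \<longleftrightarrow> x \<le> ennreal_powr y r"
  using ennreal_powr_le_iff[of "1/r" x "ennreal_powr y r"] ennreal_powr_inverse[OF assms, of y] assms by simp

lemma ennreal_powr_eq_0_iff: "ennreal_powr x r = 0 \<longleftrightarrow> x = 0"
  by (cases x rule: ennreal_cases) (simp_all add: ennreal_powr_def)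

subsection \<open>The local cost\<close>

definition barycentric :: "'i set \<Rightarrow> ('i \<Rightarrow> 'a::real_vector) \<Rightarrow> 'a \<Rightarrow> ('i \<Rightarrow> real) \<Rightarrow> bool" where
  "barycentric I \<gamma> \<xi> l \<longleftrightarrow> (\<forall>i\<in>I. 0 \<le> l i) \<and> sum l I = 1 \<and> (\<Sum>i\<in>I. l i *\<^sub>R \<gamma> i) = \<xi>"

lemma barycentric_le_1:
  assumes "finite I" "barycentric I \<gamma> \<xi> l" "i \<in> I"
  shows "l i \<le> 1"
  using assms member_le_sum[of i I l] by (auto simp: barycentric_def)

definition moment :: "('a::real_vector \<Rightarrow> real) \<Rightarrow> real \<Rightarrow> 'i set \<Rightarrow> ('i \<Rightarrow> 'a) \<Rightarrow> 'a \<Rightarrow> ('i \<Rightarrow> real) \<Rightarrow> real" where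
  "moment N p I \<gamma> \<xi> l = (\<Sum>i\<in>I. l i * N (\<xi> - \<gamma> i) powr p)"

text \<open>The \<open>p\<close>-th power of the local error.\<close>

definition cost :: "('a::real_vector \<Rightarrow> real) \<Rightarrow> real \<Rightarrow> 'i set \<Rightarrow> ('i \<Rightarrow> 'a) \<Rightarrow> 'a \<Rightarrow> ennreal" where
  "cost N p I \<gamma> \<xi> = (INF l\<in>{l. barycentric I \<gamma> \<xi> l}. ennreal (moment N p I \<gamma> \<xi> l))"

lemma moment_nonneg: "barycentric I \<gamma> \<xi> l \<Longrightarrow> 0 \<le> moment N p I \<gamma> \<xi> l"
  by (auto simp: moment_def barycentric_def intro!: sum_nonneg)

lemma cost_le: "barycentric I \<gamma> \<xi> l \<Longrightarrow> moment N p I \<gamma> \<xi> l \<le> c \<Longrightarrow> cost N p I \<gamma> \<xi> \<le> ennreal c"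
  unfolding cost_def by (rule INF_lower2) (auto intro: ennreal_leI)

lemma cost_less_ennrealE:
  assumes "cost N p I \<gamma> \<xi> < ennreal c"
  obtains l where "barycentric I \<gamma> \<xi> l" "moment N p I \<gamma> \<xi> l < c"
proof -
  obtain l where l: "barycentric I \<gamma> \<xi> l" "ennreal (moment N p I \<gamma> \<xi> l) < ennreal c"
    using assms by (auto simp: cost_def INF_less_iff)
  then show ?thesis using that[OF l(1)] moment_nonneg[OF l(1)] by (simp add: ennreal_less_iff)
qed

section \<open>Comparison of the given norm with the Euclidean norm\<close>

locale vector_norm =
  fixes N :: "'a::euclidean_space \<Rightarrow> real"
  assumes norm_like: "is_norm N"
begin

lemma N_nonneg [simp]: "0 \<le> N x"
  and N_eq_0_iff [simp]: "N x = 0 \<longleftrightarrow> x = 0"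
  and N_scale: "N (c *\<^sub>R x) = \<bar>c\<bar> * N x"
  and N_triangle: "N (x + y) \<le> N x + N y"
  using norm_like by (auto simp: is_norm_def)

lemma N_zero [simp]: "N 0 = 0"
  by simp

text \<open>Homogeneity and the triangle inequality give convexity, and a finite convex function on
  a finite-dimensional space is continuous.\<close>

lemma N_continuous: "continuous_on UNIV N"
proof (rule convex_on_continuous)
  show "convex_on UNIV N"
  proof (rule convex_onI)
    fix t :: real and x y
    assume "0 < t" "t < 1"
    then show "N ((1 - t) *\<^sub>R x + t *\<^sub>R y) \<le> (1 - t) * N x + t * N y"
      using N_triangle[of "(1 - t) *\<^sub>R x" "t *\<^sub>R y"] by (simp add: N_scale)
  qed simp
qed simp

lemma tendsto_N [tendsto_intros]: "(f \<longlongrightarrow> a) F \<Longrightarrow> ((\<lambda>x. N (f x)) \<longlongrightarrow> N a) F"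
  using N_continuous continuous_on_tendsto_compose[of UNIV N f a F] by auto

text \<open>By compactness \<open>N\<close> has a positive minimum on the Euclidean unit sphere;
  homogeneity extends the bound. It converts Euclidean escape to infinity into growth of
  \<open>N\<close>.\<close>

lemma norm_le_N: obtains K where "K > 0" "\<And>x. norm x \<le> K * N x"
proof -
  obtain u where u: "norm u = 1" "\<And>x. norm x = 1 \<Longrightarrow> N u \<le> N x"
    using continuous_attains_inf[of "sphere 0 1" N] continuous_on_subset[OF N_continuous] by auto
  then have "N u \<noteq> 0" by auto
  then have pos: "N u > 0" using N_nonneg[of u] by linarith
  have "norm x \<le> (1 / N u) * N x" for x
  proof (cases "x = 0")
    case False
    then have "N u \<le> N ((1 / norm x) *\<^sub>R x)" by (intro u(2)) simp
    then show ?thesis using pos False by (simp add: N_scale field_simps)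
  qed simp
  then show ?thesis using that[of "1 / N u"] pos by auto
qed

end

section \<open>Limits of barycentric weights and semicontinuity of the local cost\<close>

locale dual_quantization_cost = vector_norm +
  fixes p :: real
  assumes p_ge_1: "p \<ge> 1"
begin

lemma tendsto_N_powr [tendsto_intros]:
  "(f \<longlongrightarrow> a) F \<Longrightarrow> ((\<lambda>x. N (f x) powr p) \<longlongrightarrow> N a powr p) F"
  using p_ge_1 by (intro tendsto_powr' tendsto_intros) auto

text \<open>Moments are bounded and \<open>p > 1\<close>, so a grid point escaping to infinity carries a weight
  that decays faster than its distance grows, and it disappears from the barycentre in the limit.\<close>

lemma escaping_weight_tendsto_0:
  fixes l :: "nat \<Rightarrow> real"
  assumes "p > 1"
    and "xi \<longlonglongrightarrow> \<xi>"
    and esc: "filterlim (\<lambda>k. norm (g k)) at_top sequentially"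
    and l0: "\<And>k. 0 \<le> l k"
    and le: "\<And>k. l k * N (xi k - g k) powr p \<le> B"
  shows "l \<longlonglongrightarrow> 0" "(\<lambda>k. l k *\<^sub>R g k) \<longlonglongrightarrow> 0"
proof -
  define a where "a k = N (xi k - g k)" for k
  obtain K where K: "K > 0" "\<And>x. norm x \<le> K * N x" using norm_le_N by blast
  obtain R where R: "\<And>k. norm (xi k) \<le> R"
    using LIMSEQ_imp_bounded_above[OF tendsto_norm[OF assms(2)]] by blast
  have gle: "norm (g k) \<le> R + K * a k" for k
    using norm_triangle_ineq[of "xi k" "g k - xi k"] K(2)[of "xi k - g k"] R[of k]
    by (simp add: a_def norm_minus_commute)
  have a_top: "filterlim a at_top sequentially"
  proof (rule filterlim_at_top_mono)
    show "filterlim (\<lambda>k. (1 / K) * (-R + norm (g k))) at_top sequentially"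
      using K(1) by (intro filterlim_tendsto_pos_mult_at_top[OF tendsto_const]
          filterlim_tendsto_add_at_top[OF tendsto_const] esc) auto
    show "\<forall>\<^sub>F k in sequentially. (1 / K) * (-R + norm (g k)) \<le> a k"
      using gle K(1) by (auto simp: field_simps)
  qed
  have ev: "\<forall>\<^sub>F k in sequentially. 1 \<le> a k" using a_top by (auto simp: filterlim_at_top)
  have "(\<lambda>k. a k powr (1 - p)) \<longlonglongrightarrow> 0"
    using assms(1) by (intro tendsto_neg_powr a_top) auto
  then have lim: "(\<lambda>k. B * a k powr (1 - p)) \<longlonglongrightarrow> 0"
    using tendsto_mult_right_zero by blast
  \<comment> \<open>The bound on l * a^p gives l * a \<le> B * a^(1-p), where the exponent is
    negative because p > 1. Since a is eventually at least 1, this also dominates l itself.\<close>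
  have la: "(\<lambda>k. l k * a k) \<longlonglongrightarrow> 0"
  proof (rule tendsto_sandwich[OF _ _ tendsto_const lim])
    show "\<forall>\<^sub>F k in sequentially. 0 \<le> l k * a k" using l0 by (simp add: a_def)
    show "\<forall>\<^sub>F k in sequentially. l k * a k \<le> B * a k powr (1 - p)"
      using ev
    proof eventually_elim
      case (elim k)
      then have "l k * a k = (l k * a k powr p) * a k powr (1 - p)"
        by (simp add: mult.assoc powr_add [symmetric])
      also have "\<dots> \<le> B * a k powr (1 - p)"
        using le[of k] by (intro mult_right_mono) (auto simp: a_def)
      finally show ?case .
    qed
  qed
  show l: "l \<longlonglongrightarrow> 0"
  proof (rule tendsto_sandwich[OF _ _ tendsto_const la])
    show "\<forall>\<^sub>F k in sequentially. l k \<le> l k * a k"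
      using ev by eventually_elim (use l0 mult_left_mono[of 1] in force)
  qed (simp add: l0)
  show "(\<lambda>k. l k *\<^sub>R g k) \<longlonglongrightarrow> 0"
  proof (rule Lim_null_comparison)
    show "\<forall>\<^sub>F k in sequentially. norm (l k *\<^sub>R g k) \<le> R * l k + K * (l k * a k)"
    proof (intro always_eventually allI)
      fix k
      have "l k * norm (g k) \<le> l k * (R + K * a k)" using gle l0 by (intro mult_left_mono) auto
      then show "norm (l k *\<^sub>R g k) \<le> R * l k + K * (l k * a k)" using l0 by (simp add: algebra_simps)
    qed
    show "(\<lambda>k. R * l k + K * (l k * a k)) \<longlonglongrightarrow> 0"
      using tendsto_add[OF tendsto_mult_right_zero[OF l] tendsto_mult_right_zero[OF la]] by simp
  qed
qed

text \<open>Weights lie in [0,1], so a common subsequence converges; weights of escaping points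
  vanish together with their share of the barycentre, and what remains on \<open>J\<close>
  represents the limit point. The alternative \<open>p > 1 \<or> J = I\<close> admits p = 1 when
  nothing escapes. The bound \<open>c k\<close> may vary so that near-minimisers can be fed in, and
  convergence of the weights themselves is exported for the perturbation argument.\<close>

lemma barycentric_limit:
  fixes g :: "nat \<Rightarrow> 'i \<Rightarrow> 'a"
  assumes I: "finite I" "J \<subseteq> I" "p > 1 \<or> J = I"
    and xi: "xi \<longlonglongrightarrow> \<xi>"
    and g: "\<And>i. i \<in> J \<Longrightarrow> (\<lambda>k. g k i) \<longlonglongrightarrow> \<gamma> i"
    and esc: "\<And>i. i \<in> I - J \<Longrightarrow> filterlim (\<lambda>k. norm (g k i)) at_top sequentially"
    and l: "\<And>k. barycentric I (g k) (xi k) (l k)"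
    and le: "\<And>k. moment N p I (g k) (xi k) (l k) \<le> c k"
    and c: "c \<longlonglongrightarrow> C"
  obtains r m where "strict_mono r" "barycentric J \<gamma> \<xi> m" "moment N p J \<gamma> \<xi> m \<le> C"
    "\<And>i. i \<in> I \<Longrightarrow> (\<lambda>k. l (r k) i) \<longlonglongrightarrow> m i"
proof -
  have l01: "0 \<le> l k i" "l k i \<le> 1" if "i \<in> I" for i k
    using l[of k] barycentric_le_1[OF I(1) l[of k]] that by (auto simp: barycentric_def)
  have "\<exists>r. strict_mono r \<and> (\<forall>i\<in>I. convergent (\<lambda>k. l (r k) i))"
  proof (rule finite_common_subseq[OF I(1)])
    fix i and r :: "nat \<Rightarrow> nat" assume "i \<in> I"
    then have "\<forall>k. l (r k) i \<in> {0..1}" using l01 by auto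
    then obtain x s where "strict_mono s" "((\<lambda>k. l (r k) i) \<circ> s) \<longlonglongrightarrow> x"
      using seq_compactE[OF compact_imp_seq_compact[OF compact_Icc[of 0 "1::real"]], of "\<lambda>k. l (r k) i"]
      by blast
    then show "\<exists>s. strict_mono s \<and> convergent (\<lambda>k. l ((r \<circ> s) k) i)"
      by (auto simp: convergent_def o_def)
  next
    fix i and r s :: "nat \<Rightarrow> nat" assume "convergent (\<lambda>k. l (r k) i)" "strict_mono s"
    then show "convergent (\<lambda>k. l ((r \<circ> s) k) i)"
      using convergent_subseq_convergent[of "\<lambda>k. l (r k) i" s] by (simp add: o_def)
  qed
  then obtain r m where r: "strict_mono r" and m: "\<And>i. i \<in> I \<Longrightarrow> (\<lambda>k. l (r k) i) \<longlonglongrightarrow> m i"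
    unfolding convergent_def by metis
  note lims = LIMSEQ_subseq_LIMSEQ[OF _ r, unfolded o_def]
  note xir = lims[OF xi] and cr = lims[OF c]
  obtain B where B: "\<And>k. c k \<le> B"
    using LIMSEQ_imp_bounded_above[OF c] by blast
  have finJ: "finite J" using I finite_subset by blast
  have term_le: "l k i * N (xi k - g k i) powr p \<le> B" if "i \<in> I" for i k
    using that le[of k] B[of k] member_le_sum[of i I "\<lambda>i. l k i * N (xi k - g k i) powr p"] I(1) l01
    by (fastforce simp: moment_def)
  have away: "(\<lambda>k. l (r k) i) \<longlonglongrightarrow> 0" "(\<lambda>k. l (r k) i *\<^sub>R g (r k) i) \<longlonglongrightarrow> 0" if i: "i \<in> I - J" for i
  proof -
    have "p > 1" using I i by auto
    moreover have "filterlim (\<lambda>k. norm (g (r k) i)) at_top sequentially"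
      using filterlim_compose[OF esc[OF i] filterlim_subseq[OF r]] .
    ultimately show "(\<lambda>k. l (r k) i) \<longlonglongrightarrow> 0" "(\<lambda>k. l (r k) i *\<^sub>R g (r k) i) \<longlonglongrightarrow> 0"
      using escaping_weight_tendsto_0[OF _ xir, of "\<lambda>k. g (r k) i" "\<lambda>k. l (r k) i" B] i l01 term_le by auto
  qed
  have m0: "m i = 0" if "i \<in> I - J" for i
    using LIMSEQ_unique[OF m away(1)] that by auto
  have near: "(\<lambda>k. g (r k) i) \<longlonglongrightarrow> \<gamma> i" if "i \<in> J" for i
    using lims[OF g[OF that]] .
  have "(\<lambda>k. \<Sum>i\<in>I. l (r k) i) \<longlonglongrightarrow> (\<Sum>i\<in>I. m i)"
    by (intro tendsto_sum m)
  moreover have "(\<Sum>i\<in>I. l (r k) i) = 1" for k using l by (simp add: barycentric_def)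
  ultimately have "sum m I = 1" by (simp add: LIMSEQ_const_iff)
  moreover have "sum m I = sum m J" using I m0 by (intro sum.mono_neutral_right) auto
  ultimately have s1: "sum m J = 1" by simp
  have "(\<lambda>k. \<Sum>i\<in>I. l (r k) i *\<^sub>R g (r k) i) \<longlonglongrightarrow> (\<Sum>i\<in>I. if i \<in> J then m i *\<^sub>R \<gamma> i else 0)"
  proof (intro tendsto_sum)
    fix i assume "i \<in> I"
    then show "(\<lambda>k. l (r k) i *\<^sub>R g (r k) i) \<longlonglongrightarrow> (if i \<in> J then m i *\<^sub>R \<gamma> i else 0)"
      using away(2)[of i] tendsto_scaleR[OF m near, of i i] by auto
  qed
  moreover have "(\<Sum>i\<in>I. l (r k) i *\<^sub>R g (r k) i) = xi (r k)" for k using l by (simp add: barycentric_def)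
  moreover have "(\<Sum>i\<in>I. if i \<in> J then m i *\<^sub>R \<gamma> i else 0) = (\<Sum>i\<in>J. m i *\<^sub>R \<gamma> i)"
    using I by (intro sum.mono_neutral_cong_right) auto
  ultimately have s2: "(\<Sum>i\<in>J. m i *\<^sub>R \<gamma> i) = \<xi>" using LIMSEQ_unique[OF xir] by simp
  have "0 \<le> m i" if "i \<in> J" for i
    using that I l01 by (intro LIMSEQ_le_const[OF m]) auto
  then have bary: "barycentric J \<gamma> \<xi> m" using s1 s2 by (auto simp: barycentric_def)
  have "(\<lambda>k. \<Sum>i\<in>J. l (r k) i * N (xi (r k) - g (r k) i) powr p)
      \<longlonglongrightarrow> (\<Sum>i\<in>J. m i * N (\<xi> - \<gamma> i) powr p)"
    using I by (intro tendsto_intros m near xir) auto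
  \<comment> \<open>All terms are nonnegative, so discarding the escaping points can only lower the
    moment.\<close>
  moreover have "(\<Sum>i\<in>J. l (r k) i * N (xi (r k) - g (r k) i) powr p) \<le> c (r k)" for k
  proof -
    have "(\<Sum>i\<in>J. l (r k) i * N (xi (r k) - g (r k) i) powr p) \<le> moment N p I (g (r k)) (xi (r k)) (l (r k))"
      unfolding moment_def using I l01 by (intro sum_mono2) auto
    then show ?thesis using le[of "r k"] by linarith
  qed
  ultimately have "moment N p J \<gamma> \<xi> m \<le> C"
    unfolding moment_def using LIMSEQ_le[OF _ cr] by blast
  then show ?thesis using that[OF r bary _ m] by blast
qed

text \<open>The limit lemma is applied to a constant point and a constant grid, with weights that
  are optimal up to 1/(k+1).\<close>

lemma cost_attained:
  assumes "finite I" "cost N p I \<gamma> \<xi> < \<infinity>"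
  obtains l where "barycentric I \<gamma> \<xi> l" "cost N p I \<gamma> \<xi> = ennreal (moment N p I \<gamma> \<xi> l)"
proof -
  obtain C where C: "cost N p I \<gamma> \<xi> = ennreal C" "C \<ge> 0" using assms(2) by (cases "cost N p I \<gamma> \<xi>") auto
  have "\<exists>l. barycentric I \<gamma> \<xi> l \<and> moment N p I \<gamma> \<xi> l \<le> C + 1 / Suc k" for k
  proof -
    have "cost N p I \<gamma> \<xi> < ennreal (C + 1 / Suc k)" using C by (simp add: ennreal_less_iff)
    then show ?thesis by (metis cost_less_ennrealE less_imp_le)
  qed
  then obtain l where l: "\<And>k. barycentric I \<gamma> \<xi> (l k)" "\<And>k. moment N p I \<gamma> \<xi> (l k) \<le> C + 1 / Suc k"
    by metis
  have lim: "(\<lambda>k. C + 1 / Suc k) \<longlonglongrightarrow> C"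
    using tendsto_add[OF tendsto_const[of C] LIMSEQ_inverse_real_of_nat] by (simp add: inverse_eq_divide)
  obtain m where "barycentric I \<gamma> \<xi> m" "moment N p I \<gamma> \<xi> m \<le> C"
    using barycentric_limit[OF assms(1) subset_refl _ tendsto_const _ _ l(1) l(2) lim, of \<gamma>] by auto
  then show ?thesis using that[of m] cost_le[of I \<gamma> \<xi> m N p "moment N p I \<gamma> \<xi> m"] C
    by (metis antisym ennreal_leI order_refl)
qed

text \<open>If the inequality fails, a level \<open>b\<close> strictly between the two sides is
  finite. Along a subsequence the cost stays below \<open>b\<close>, so admissible weights exist
  there even if the cost is infinite elsewhere, and their limit contradicts the choice of
  \<open>b\<close>.\<close>

lemma cost_le_liminf:
  fixes g :: "nat \<Rightarrow> 'i \<Rightarrow> 'a"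
  assumes I: "finite I" "J \<subseteq> I" "p > 1 \<or> J = I"
    and xi: "xi \<longlonglongrightarrow> \<xi>"
    and g: "\<And>i. i \<in> J \<Longrightarrow> (\<lambda>k. g k i) \<longlonglongrightarrow> \<gamma> i"
    and esc: "\<And>i. i \<in> I - J \<Longrightarrow> filterlim (\<lambda>k. norm (g k i)) at_top sequentially"
  shows "cost N p J \<gamma> \<xi> \<le> liminf (\<lambda>k. cost N p I (g k) (xi k))"
proof (rule ccontr)
  assume "\<not> ?thesis"
  then obtain b where b: "liminf (\<lambda>k. cost N p I (g k) (xi k)) < b" "b < cost N p J \<gamma> \<xi>"
    using dense[of "liminf (\<lambda>k. cost N p I (g k) (xi k))" "cost N p J \<gamma> \<xi>"]
    by (auto simp: not_le)
  then have "b < top" using less_le_trans top_greatest by blast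
  then obtain c where c: "b = ennreal c" by (auto simp: less_top_ennreal)
  have "\<not> (\<forall>\<^sub>F k in sequentially. b \<le> cost N p I (g k) (xi k))"
    using Liminf_bounded[of b "\<lambda>k. cost N p I (g k) (xi k)" sequentially] b(1) by auto
  from not_eventually_sequentiallyD[OF this]
  obtain r :: "nat \<Rightarrow> nat" where r: "strict_mono r" "\<forall>k. cost N p I (g (r k)) (xi (r k)) < b"
    unfolding not_le by blast
  have "\<exists>l. barycentric I (g (r k)) (xi (r k)) l \<and> moment N p I (g (r k)) (xi (r k)) l \<le> c" for k
    using r(2)[rule_format, of k] unfolding c by (metis cost_less_ennrealE less_imp_le)
  then obtain l where l: "\<And>k. barycentric I (g (r k)) (xi (r k)) (l k)"
      "\<And>k. moment N p I (g (r k)) (xi (r k)) (l k) \<le> c"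
    by metis
  note lims = LIMSEQ_subseq_LIMSEQ[OF _ r(1), unfolded o_def]
  have "filterlim (\<lambda>k. norm (g (r k) i)) at_top sequentially" if "i \<in> I - J" for i
    using filterlim_compose[OF esc[OF that] filterlim_subseq[OF r(1)]] .
  then obtain m where "barycentric J \<gamma> \<xi> m" "moment N p J \<gamma> \<xi> m \<le> c"
    using barycentric_limit[OF I lims[OF xi] lims[OF g] _ l tendsto_const] by metis
  then have "cost N p J \<gamma> \<xi> \<le> b" unfolding c by (rule cost_le)
  then show False using b(2) by auto
qed

text \<open>The infimum runs over uncountably many weights that depend on the point, so
  measurability is taken from semicontinuity: sublevel sets are closed.\<close>

lemma cost_measurable [measurable]:
  assumes "finite I"
  shows "cost N p I \<gamma> \<in> borel_measurable borel"
proof (rule borel_measurableI_le)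
  fix y
  have "closed {x. cost N p I \<gamma> x \<le> y}"
    unfolding closed_sequential_limits
  proof (intro allI impI, elim conjE)
    fix x \<xi> assume x: "\<forall>n. x n \<in> {x. cost N p I \<gamma> x \<le> y}" "x \<longlonglongrightarrow> \<xi>"
    have "cost N p I \<gamma> \<xi> \<le> liminf (\<lambda>k. cost N p I \<gamma> (x k))"
      using assms x(2) by (intro cost_le_liminf) auto
    also have "\<dots> \<le> y"
      using x(1) by (intro Liminf_le) auto
    finally show "\<xi> \<in> {x. cost N p I \<gamma> x \<le> y}" by simp
  qed
  then show "{x \<in> space borel. cost N p I \<gamma> x \<le> y} \<in> sets borel" by simp
qed

text \<open>Attainment turns a zero infimum into a vanishing sum of nonnegative terms. Some weight
  is nonzero, and its grid point must then be \<xi>.\<close>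

lemma cost_eq_0_iff:
  assumes "finite I"
  shows "cost N p I \<gamma> \<xi> = 0 \<longleftrightarrow> \<xi> \<in> \<gamma> ` I"
proof
  assume 0: "cost N p I \<gamma> \<xi> = 0"
  then obtain l where l: "barycentric I \<gamma> \<xi> l" "moment N p I \<gamma> \<xi> l = 0"
    using cost_attained[OF assms, of \<gamma> \<xi>] moment_nonneg[of I \<gamma> \<xi> _ N p]
    by (metis ennreal_eq_0_iff ennreal_zero_less_top infinity_ennreal_def antisym)
  have "\<exists>i\<in>I. l i \<noteq> 0" using l(1) by (metis barycentric_def sum.neutral zero_neq_one)
  then obtain i where i: "i \<in> I" "l i \<noteq> 0" by blast
  have "l i * N (\<xi> - \<gamma> i) powr p = 0"
    using l i assms sum_nonneg_eq_0_iff[OF assms, of "\<lambda>i. l i * N (\<xi> - \<gamma> i) powr p"]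
    by (auto simp: moment_def barycentric_def)
  then show "\<xi> \<in> \<gamma> ` I" using i by auto
next
  assume "\<xi> \<in> \<gamma> ` I"
  then obtain i where i: "i \<in> I" "\<xi> = \<gamma> i" by auto
  have eq: "(if j = i then 1 else 0) *\<^sub>R \<gamma> j = (if j = i then \<gamma> i else 0)"
    "(if j = i then 1 else 0) * N (\<gamma> i - \<gamma> j) powr p = 0" for j
    by auto
  have "barycentric I \<gamma> \<xi> (\<lambda>j. if j = i then 1 else 0)"
    using assms i by (simp add: barycentric_def eq)
  moreover have "moment N p I \<gamma> \<xi> (\<lambda>j. if j = i then 1 else 0) \<le> 0"
    unfolding moment_def using i by (intro eq_refl sum.neutral) auto
  ultimately have "cost N p I \<gamma> \<xi> \<le> ennreal 0" by (rule cost_le)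
  then show "cost N p I \<gamma> \<xi> = 0" by simp
qed

end

text \<open>Weights on \<open>J\<close> are pushed forward along a map \<open>s\<close> that sends
  each index to one carrying the same point; barycentre and moment are preserved. This yields both
  monotonicity under enlarging the grid and dependence on the value set alone.\<close>

lemma cost_image_mono:
  assumes "finite I" "finite J" "g ` J \<subseteq> h ` I"
  shows "cost N p I h \<xi> \<le> cost N p J g \<xi>"
  unfolding cost_def[of N p J]
proof (rule INF_greatest)
  fix l assume "l \<in> {l. barycentric J g \<xi> l}"
  then have l: "barycentric J g \<xi> l" by simp
  have ex: "\<forall>j\<in>J. \<exists>i. i \<in> I \<and> h i = g j" using assms(3) by (force simp: image_subset_iff)
  obtain s where s: "\<And>j. j \<in> J \<Longrightarrow> s j \<in> I" "\<And>j. j \<in> J \<Longrightarrow> h (s j) = g j"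
    using bchoice[OF ex] by blast
  define l' where "l' i = (\<Sum>j | j \<in> J \<and> s j = i. l j)" for i
  have group: "(\<Sum>i\<in>I. \<Sum>j | j \<in> J \<and> s j = i. F j) = sum F J" for F :: "_ \<Rightarrow> 'z::comm_monoid_add"
    using s(1) assms by (intro sum.group) auto
  have sum1: "(\<Sum>i\<in>I. l' i *\<^sub>R h i) = (\<Sum>j\<in>J. l j *\<^sub>R g j)"
    unfolding l'_def scaleR_sum_left group[of "\<lambda>j. l j *\<^sub>R g j", symmetric]
    using s(2) by (intro sum.cong) auto
  have sum2: "moment N p I h \<xi> l' = moment N p J g \<xi> l"
    unfolding moment_def l'_def sum_distrib_right group[of "\<lambda>j. l j * N (\<xi> - g j) powr p", symmetric]
    using s(2) by (intro sum.cong) auto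
  have "sum l' I = sum l J" unfolding l'_def by (rule group)
  moreover have "0 \<le> l' i" for i using l by (auto simp: l'_def barycentric_def intro: sum_nonneg)
  ultimately have "barycentric I h \<xi> l'" using l sum1 by (simp add: barycentric_def)
  then show "cost N p I h \<xi> \<le> ennreal (moment N p J g \<xi> l)"
    using cost_le sum2 by (metis order_refl)
qed

subsection \<open>Supports and grids\<close>

text \<open>A countable basis makes the union of all null basic open sets a null set, and every
  point outside that union lies in the support.\<close>

lemma AE_in_measure_supp:
  fixes \<mu> :: "'a::second_countable_topology measure"
  assumes sets: "sets \<mu> = sets borel"
  shows "AE x in \<mu>. x \<in> measure_supp \<mu>"
proof -
  obtain B :: "'a set set" where B: "countable B" "topological_basis B"
    using ex_countable_basis by blast
  define B0 where "B0 = {b \<in> B. emeasure \<mu> b = 0}"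
  have "(\<Union>b\<in>B0. b) \<in> null_sets \<mu>"
  proof (rule null_sets_UN')
    show "countable B0" using B(1) by (simp add: B0_def)
    show "b \<in> null_sets \<mu>" if "b \<in> B0" for b
      using that topological_basis_open[OF B(2), of b] sets by (auto simp: B0_def null_sets_def)
  qed
  from AE_not_in[OF this] show ?thesis
  proof eventually_elim
    case (elim x)
    show ?case
      unfolding measure_supp_def
    proof safe
      fix U :: "'a set" assume U: "open U" "x \<in> U"
      then obtain b where b: "b \<in> B" "x \<in> b" "b \<subseteq> U" using topological_basisE[OF B(2)] by metis
      then have "0 < emeasure \<mu> b" using elim by (auto simp: B0_def zero_less_iff_neq_zero)
      also have "\<dots> \<le> emeasure \<mu> U" using b U sets by (intro emeasure_mono) auto
      finally show "0 < emeasure \<mu> U" .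
    qed
  qed
qed

text \<open>This turns almost sure properties into actual points arbitrarily close to a given
  support point, from which sequences can be chosen.\<close>

lemma measure_supp_distr_meets:
  assumes X: "X \<in> borel_measurable M"
    and x: "x \<in> measure_supp (distr M borel X)"
    and P: "AE \<omega> in M. P (X \<omega>)"
    and U: "open U" "x \<in> U"
  shows "\<exists>y\<in>U. P y"
proof (rule ccontr)
  assume "\<not> ?thesis"
  then have "AE \<omega> in M. \<not> (X \<omega> \<in> U)" using P by (auto elim: eventually_mono)
  then have "emeasure M (X -` U \<inter> space M) = 0"
    using AE_iff_measurable[of "X -` U \<inter> space M" M "\<lambda>\<omega>. \<not> (X \<omega> \<in> U)"]
      measurable_sets[OF X borel_open[OF U(1)]]
    by (auto simp: vimage_def Int_def conj_commute)
  then have "emeasure (distr M borel X) U = 0" using X U(1) by (simp add: emeasure_distr)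
  then show False using x U by (auto simp: measure_supp_def)
qed

lemma measure_supp_distr_subset_closed:
  assumes "X \<in> borel_measurable M" "AE \<omega> in M. X \<omega> \<in> C" "closed C"
  shows "measure_supp (distr M borel X) \<subseteq> C"
  using measure_supp_distr_meets[OF assms(1) _ assms(2), of _ "- C"] assms(3) by auto

lemma bounded_subset_simplex:
  fixes S :: "'a::euclidean_space set"
  assumes "bounded S"
  obtains \<Gamma> where "finite \<Gamma>" "\<Gamma> \<noteq> {}" "card \<Gamma> \<le> DIM('a) + 1" "S \<subseteq> convex hull \<Gamma>"
proof -
  obtain R where R: "R > 0" "\<And>x. x \<in> S \<Longrightarrow> norm x \<le> R" using assms bounded_pos by metis
  define a :: 'a where "a = (\<Sum>b\<in>Basis. (-R) *\<^sub>R b)"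
  \<comment> \<open>Relative to the corner \<open>a\<close>, coordinates range over [0, 2R].
    Division by \<open>c\<close> leaves at most 1/d for each of the d coordinates, so their sum is
    at most 1 and the standard simplex is reached.\<close>
  define c where "c = 2 * R * DIM('a)"
  have c: "c > 0" using R by (simp add: c_def)
  have ab: "a \<bullet> b = -R" if "b \<in> Basis" for b
    unfolding a_def using that by (subst inner_sum_left_Basis) auto
  define \<Gamma> where "\<Gamma> = (\<lambda>x. a + c *\<^sub>R x) ` insert 0 Basis"
  have "S \<subseteq> (\<lambda>x. a + c *\<^sub>R x) ` (convex hull (insert 0 Basis))"
  proof
    fix x assume x: "x \<in> S"
    define y where "y = (1 / c) *\<^sub>R (x - a)"
    have "\<bar>x \<bullet> b\<bar> \<le> R" if "b \<in> Basis" for b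
      using Basis_le_norm[OF that, of x] R(2)[OF x] by linarith
    then have yb: "0 \<le> y \<bullet> b \<and> y \<bullet> b \<le> 2 * R / c" if "b \<in> Basis" for b
      using that c ab[OF that] by (force simp: y_def inner_diff_left field_simps abs_le_iff)
    have "(\<Sum>b\<in>Basis. y \<bullet> b) \<le> (\<Sum>b\<in>(Basis :: 'a set). 2 * R / c)"
      using yb by (intro sum_mono) auto
    also have "\<dots> = 1" using R c by (simp add: c_def)
    finally have "y \<in> convex hull (insert 0 Basis)" using yb by (simp add: std_simplex)
    moreover have "x = a + c *\<^sub>R y" using c by (simp add: y_def)
    ultimately show "x \<in> (\<lambda>x. a + c *\<^sub>R x) ` (convex hull (insert 0 Basis))" by blast
  qed
  then have "S \<subseteq> convex hull \<Gamma>" unfolding \<Gamma>_def convex_hull_affinity .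
  moreover have "card \<Gamma> \<le> DIM('a) + 1"
    unfolding \<Gamma>_def using card_image_le[of "insert 0 Basis" "\<lambda>x. a + c *\<^sub>R x"] card_insert_le_m1[of "DIM('a) + 1" Basis "0::'a"] by simp
  ultimately show ?thesis using that[of \<Gamma>] by (simp add: \<Gamma>_def)
qed

lemma tuple_with_range:
  assumes "finite \<Gamma>" "\<Gamma> \<noteq> {}" "card \<Gamma> \<le> n"
  obtains \<gamma> where "\<gamma> \<in> {..<n} \<rightarrow>\<^sub>E UNIV" "\<gamma> ` {..<n} = \<Gamma>"
proof -
  obtain f where f: "f ` \<Gamma> \<subseteq> {..<n}" "inj_on f \<Gamma>"
    using card_le_inj[of \<Gamma> "{..<n}"] assms by auto
  obtain a where a: "a \<in> \<Gamma>" using assms by auto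
  \<comment> \<open>Surplus indices repeat the point \<open>a\<close>; beyond \<open>n\<close> the
    value must be \<open>undefined\<close> for the tuple to be extensional.\<close>
  define \<gamma> where "\<gamma> i = (if i < n then if i \<in> f ` \<Gamma> then inv_into \<Gamma> f i else a else undefined)" for i
  have "\<gamma> (f x) = x" if "x \<in> \<Gamma>" for x using f that by (auto simp: \<gamma>_def)
  moreover have "\<gamma> i \<in> \<Gamma>" if "i < n" for i using that a inv_into_into[of i f \<Gamma>] by (auto simp: \<gamma>_def)
  ultimately have "\<gamma> ` {..<n} = \<Gamma>" using f by (force simp: image_subset_iff)
  moreover have "\<gamma> \<in> {..<n} \<rightarrow>\<^sub>E UNIV" by (auto simp: \<gamma>_def PiE_def extensional_def)
  ultimately show ?thesis using that by blast
qed

text \<open>Both alternatives pass to further subsequences, so the dichotomy can be arranged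
  simultaneously for all points of a grid.\<close>

lemma convergent_or_unbounded_subseq:
  fixes g :: "nat \<Rightarrow> 'a::euclidean_space"
  shows "\<exists>s. strict_mono s \<and>
    (convergent (\<lambda>k. g (s k)) \<or> filterlim (\<lambda>k. norm (g (s k))) at_top sequentially)"
proof (cases "filterlim (\<lambda>k. norm (g k)) at_top sequentially")
  case True
  then show ?thesis using strict_mono_id by (intro exI[of _ id]) auto
next
  case False
  then obtain Z where "\<not> (\<forall>\<^sub>F k in sequentially. Z \<le> norm (g k))" by (auto simp: filterlim_at_top)
  from not_eventually_sequentiallyD[OF this]
  obtain r :: "nat \<Rightarrow> nat" where r: "strict_mono r" "\<forall>k. \<not> Z \<le> norm (g (r k))"
    by blast
  then have "\<forall>k. g (r k) \<in> cball 0 Z" by (auto simp: not_le less_imp_le)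
  then obtain x s where s: "strict_mono s" "((\<lambda>k. g (r k)) \<circ> s) \<longlonglongrightarrow> x"
    using seq_compactE[OF compact_imp_seq_compact[OF compact_cball], of "\<lambda>k. g (r k)" 0 Z] by blast
  then show ?thesis
    using strict_mono_o[OF r(1) s(1)] by (intro exI[of _ "r \<circ> s"]) (auto simp: convergent_def o_def)
qed

text \<open>The root commutes with the infimum: monotonicity gives one inequality, attainment of the
  cost the other. The upper bound on the weights is supplied by
  \<open>barycentric_le_1\<close>.\<close>

lemma dual_quantization_cost_dq_local:
  fixes N :: "real ^ 'd \<Rightarrow> real"
  assumes "dual_quantization_cost N p"
  shows "ennreal_powr (dq_local N p n \<xi> \<gamma>) p = cost N p {..<n} \<gamma> \<xi>"
proof -
  interpret dual_quantization_cost N p by fact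
  have p: "p > 0" using p_ge_1 by simp
  have eq: "dq_local N p n \<xi> \<gamma> =
      (INF l\<in>{l. barycentric {..<n} \<gamma> \<xi> l}. ennreal_powr (ennreal (moment N p {..<n} \<gamma> \<xi> l)) (1 / p))"
    (is "_ = ?I")
    unfolding dq_local_def
  proof (intro arg_cong[of _ _ Inf] set_eqI iffI)
    fix y
    assume "y \<in> {ennreal ((\<Sum>i<n. l i * N (\<xi> - \<gamma> i) powr p) powr (1 / p)) | l.
      (\<forall>i<n. 0 \<le> l i \<and> l i \<le> (1::real)) \<and> (\<Sum>i<n. l i *\<^sub>R \<gamma> i) = \<xi> \<and> (\<Sum>i<n. l i) = 1}"
    then obtain l where l: "barycentric {..<n} \<gamma> \<xi> l"
      and y: "y = ennreal (moment N p {..<n} \<gamma> \<xi> l powr (1 / p))"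
      by (auto simp: barycentric_def moment_def)
    then show "y \<in> (\<lambda>l. ennreal_powr (ennreal (moment N p {..<n} \<gamma> \<xi> l)) (1 / p)) ` {l. barycentric {..<n} \<gamma> \<xi> l}"
      using moment_nonneg[OF l, of N p] by (intro image_eqI[of _ _ l]) (auto simp: ennreal_powr_def)
  next
    fix y
    assume "y \<in> (\<lambda>l. ennreal_powr (ennreal (moment N p {..<n} \<gamma> \<xi> l)) (1 / p)) ` {l. barycentric {..<n} \<gamma> \<xi> l}"
    then obtain l where l: "barycentric {..<n} \<gamma> \<xi> l"
      and y: "y = ennreal_powr (ennreal (moment N p {..<n} \<gamma> \<xi> l)) (1 / p)"
      by auto
    then show "y \<in> {ennreal ((\<Sum>i<n. l i * N (\<xi> - \<gamma> i) powr p) powr (1 / p)) | l.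
      (\<forall>i<n. 0 \<le> l i \<and> l i \<le> (1::real)) \<and> (\<Sum>i<n. l i *\<^sub>R \<gamma> i) = \<xi> \<and> (\<Sum>i<n. l i) = 1}"
      using barycentric_le_1[OF _ l] moment_nonneg[OF l, of N p]
      by (intro CollectI exI[of _ l]) (auto simp: barycentric_def moment_def ennreal_powr_def)
  qed
  have "?I = ennreal_powr (cost N p {..<n} \<gamma> \<xi>) (1 / p)"
  proof (rule antisym)
    show "?I \<le> ennreal_powr (cost N p {..<n} \<gamma> \<xi>) (1 / p)"
    proof (cases "cost N p {..<n} \<gamma> \<xi> < \<infinity>")
      case True
      then obtain l where "barycentric {..<n} \<gamma> \<xi> l" "cost N p {..<n} \<gamma> \<xi> = ennreal (moment N p {..<n} \<gamma> \<xi> l)"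
        using cost_attained[of "{..<n}"] by auto
      then show ?thesis by (auto intro: INF_lower2)
    qed (simp add: ennreal_powr_def top.not_eq_extremum)
    show "ennreal_powr (cost N p {..<n} \<gamma> \<xi>) (1 / p) \<le> ?I"
      using p by (intro INF_greatest ennreal_powr_mono) (auto simp: cost_def intro: INF_lower)
  qed
  then show ?thesis using ennreal_powr_inverse[of "1 / p"] p unfolding eq by simp
qed

subsection \<open>The mean cost\<close>

locale dual_quantization = dual_quantization_cost N p + prob_space M
  for N :: "real ^ 'd \<Rightarrow> real" and p :: real and M :: "'w measure" +
  fixes X :: "'w \<Rightarrow> real ^ 'd"
  assumes X_measurable [measurable]: "X \<in> borel_measurable M"
begin

text \<open>The p-th power of the mean error. Taking the root only at the end keeps it an integral,
  open to Fatou's lemma.\<close>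

definition energy :: "'i set \<Rightarrow> ('i \<Rightarrow> real ^ 'd) \<Rightarrow> ennreal" where
  "energy I \<gamma> = (\<integral>\<^sup>+ \<omega>. cost N p I \<gamma> (X \<omega>) \<partial>M)"

abbreviation grid_energy :: "(real ^ 'd) set \<Rightarrow> ennreal" where
  "grid_energy \<Gamma> \<equiv> energy \<Gamma> (\<lambda>x. x)"

definition min_energy :: "nat \<Rightarrow> ennreal" where
  "min_energy n = (INF \<gamma> \<in> {..<n} \<rightarrow>\<^sub>E UNIV. energy {..<n} \<gamma>)"

lemma p_pos: "p > 0"
  using p_ge_1 by simp

lemma cost_X_measurable [measurable]:
  "finite I \<Longrightarrow> (\<lambda>\<omega>. cost N p I \<gamma> (X \<omega>)) \<in> borel_measurable M"
  using measurable_compose[OF X_measurable cost_measurable] .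

lemma dq_error_eq: "dq_error N p M X n \<gamma> = ennreal_powr (energy {..<n} \<gamma>) (1 / p)"
  by (simp add: dq_error_def energy_def dual_quantization_cost_dq_local dual_quantization_cost_axioms)

lemma energy_image_mono:
  assumes "finite I" "finite J" "g ` J \<subseteq> h ` I"
  shows "energy I h \<le> energy J g"
  unfolding energy_def by (intro nn_integral_mono cost_image_mono assms)

lemma energy_image: "finite I \<Longrightarrow> energy I \<gamma> = grid_energy (\<gamma> ` I)"
  by (intro antisym energy_image_mono) auto

section \<open>Lower semicontinuity of the mean error\<close>

lemma energy_le_liminf:
  assumes "finite I" "J \<subseteq> I" "p > 1 \<or> J = I"
    and "\<And>i. i \<in> J \<Longrightarrow> (\<lambda>k. g k i) \<longlonglongrightarrow> \<gamma> i"
    and "\<And>i. i \<in> I - J \<Longrightarrow> filterlim (\<lambda>k. norm (g k i)) at_top sequentially"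
  shows "energy J \<gamma> \<le> liminf (\<lambda>k. energy I (g k))"
proof -
  have "energy J \<gamma> \<le> (\<integral>\<^sup>+ \<omega>. liminf (\<lambda>k. cost N p I (g k) (X \<omega>)) \<partial>M)"
    unfolding energy_def
  proof (rule nn_integral_mono)
    fix \<omega>
    show "cost N p J \<gamma> (X \<omega>) \<le> liminf (\<lambda>k. cost N p I (g k) (X \<omega>))"
      by (rule cost_le_liminf[OF assms(1-3) tendsto_const]) (use assms in auto)
  qed
  also have "\<dots> \<le> liminf (\<lambda>k. energy I (g k))"
    unfolding energy_def using assms(1) by (intro nn_integral_liminf) auto
  finally show ?thesis .
qed

text \<open>Stated on all functions on \<open>nat\<close>: a countable product is first countable,
  so closedness can be tested with sequences.\<close>

lemma closed_energy_le: "closed {\<gamma> :: nat \<Rightarrow> real ^ 'd. energy {..<n} \<gamma> \<le> b}"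
  unfolding closed_sequential_limits
proof (intro allI impI, elim conjE)
  fix g and \<gamma> :: "nat \<Rightarrow> real ^ 'd"
  assume g: "\<forall>k. g k \<in> {\<gamma>. energy {..<n} \<gamma> \<le> b}" and lim: "g \<longlonglongrightarrow> \<gamma>"
  have "(\<lambda>k. g k i) \<longlonglongrightarrow> \<gamma> i" for i
    using continuous_on_tendsto_compose[OF continuous_on_product_coordinates lim, of i] by simp
  then have "energy {..<n} \<gamma> \<le> liminf (\<lambda>k. energy {..<n} (g k))"
    by (intro energy_le_liminf) auto
  also have "\<dots> \<le> b" using g by (intro Liminf_le) auto
  finally show "\<gamma> \<in> {\<gamma>. energy {..<n} \<gamma> \<le> b}" by simp
qed

text \<open>The inclusion of tuples into all functions pulls closedness back to
  \<open>tuple_top n\<close>; its coordinates beyond \<open>n\<close> are constantly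
  \<open>undefined\<close>, hence continuous.\<close>

lemma continuous_map_tuple_top: "continuous_map (tuple_top n) euclidean (\<lambda>\<gamma>. \<gamma> :: nat \<Rightarrow> real ^ 'd)"
proof -
  have "continuous_map (tuple_top n) euclidean (\<lambda>\<gamma>. \<gamma> i :: real ^ 'd)" for i
  proof (cases "i < n")
    case True
    then show ?thesis using continuous_map_product_projection[of i "{..<n}" "\<lambda>_. euclidean"] by (simp add: tuple_top_def)
  next
    case False
    show ?thesis
    proof (rule continuous_map_eq[of "tuple_top n" euclidean "\<lambda>_. undefined"])
      show "undefined = \<gamma> i" if "\<gamma> \<in> topspace (tuple_top n)" for \<gamma> :: "nat \<Rightarrow> real ^ 'd"
        using that False by (simp add: tuple_top_def PiE_def extensional_def)
    qed simp
  qed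
  then show ?thesis
    by (simp add: euclidean_product_topology [symmetric] continuous_map_componentwise_UNIV)
qed

lemma dq_error_lower_semicontinuous: "lower_semicontinuous_map (tuple_top n) (dq_error N p M X n)"
  unfolding lower_semicontinuous_map_def
proof
  fix a
  have "openin (tuple_top n)
      {\<gamma> \<in> topspace (tuple_top n). \<gamma> \<in> - {\<gamma>. energy {..<n} \<gamma> \<le> ennreal_powr a p}}"
    using continuous_map_tuple_top closed_energy_le
    by (intro openin_continuous_map_preimage[of _ euclidean]) auto
  moreover have "a < dq_error N p M X n \<gamma> \<longleftrightarrow> \<gamma> \<in> - {\<gamma>. energy {..<n} \<gamma> \<le> ennreal_powr a p}" for \<gamma>
    unfolding dq_error_eq using ennreal_powr_root_le_iff[OF p_pos] by (auto simp: not_le [symmetric])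
  ultimately show "openin (tuple_top n) {\<gamma> \<in> topspace (tuple_top n). a < dq_error N p M X n \<gamma>}"
    by simp
qed

section \<open>Existence of optimal grids\<close>

lemma energy_empty: "energy {} \<gamma> = \<infinity>"
  by (simp add: energy_def cost_def barycentric_def emeasure_space_1)

lemma min_energy_le: "finite \<Gamma> \<Longrightarrow> card \<Gamma> \<le> n \<Longrightarrow> min_energy n \<le> grid_energy \<Gamma>"
proof (cases "\<Gamma> = {}")
  case False
  assume "finite \<Gamma>" "card \<Gamma> \<le> n"
  then obtain \<gamma> where "\<gamma> \<in> {..<n} \<rightarrow>\<^sub>E UNIV" "\<gamma> ` {..<n} = \<Gamma>"
    using tuple_with_range[OF _ False] by metis
  then show ?thesis
    unfolding min_energy_def using energy_image[of "{..<n}" \<gamma>] by (intro INF_lower2[of \<gamma>]) auto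
qed (simp add: energy_empty)

lemma min_energy_attained:
  assumes "p > 1" "n > 0"
  obtains \<gamma> where "\<gamma> \<in> {..<n} \<rightarrow>\<^sub>E UNIV" "energy {..<n} \<gamma> = min_energy n"
proof -
  have "energy {..<n} ` ({..<n} \<rightarrow>\<^sub>E UNIV) \<noteq> {}" by (simp add: PiE_eq_empty_iff)
  from Inf_as_limit[OF this] obtain u
    where u: "\<forall>k. u k \<in> energy {..<n} ` ({..<n} \<rightarrow>\<^sub>E UNIV)" "u \<longlonglongrightarrow> min_energy n"
    unfolding min_energy_def by auto
  have "\<forall>k. \<exists>\<gamma>. \<gamma> \<in> {..<n} \<rightarrow>\<^sub>E UNIV \<and> u k = energy {..<n} \<gamma>" using u(1) by blast
  then obtain g where g: "\<And>k. g k \<in> {..<n} \<rightarrow>\<^sub>E UNIV" "\<And>k. u k = energy {..<n} (g k)"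
    by metis
  show ?thesis
  proof (cases "min_energy n = \<infinity>")
    \<comment> \<open>If the infimum is infinite, every tuple is a minimiser.\<close>
    case True
    have "min_energy n \<le> energy {..<n} (g 0)" unfolding min_energy_def using g(1) by (intro INF_lower)
    then show ?thesis using that[OF g(1)] True by (simp add: top_unique)
  next
    case False
    have "\<exists>r. strict_mono r \<and> (\<forall>i\<in>{..<n}. convergent (\<lambda>k. g (r k) i) \<or>
        filterlim (\<lambda>k. norm (g (r k) i)) at_top sequentially)"
    proof (rule finite_common_subseq)
      fix i and r :: "nat \<Rightarrow> nat"
      show "\<exists>s. strict_mono s \<and> (convergent (\<lambda>k. g ((r \<circ> s) k) i) \<or>
          filterlim (\<lambda>k. norm (g ((r \<circ> s) k) i)) at_top sequentially)"
        using convergent_or_unbounded_subseq[of "\<lambda>k. g (r k) i"] by (simp add: o_def)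
    next
      fix i and r s :: "nat \<Rightarrow> nat"
      assume "convergent (\<lambda>k. g (r k) i) \<or> filterlim (\<lambda>k. norm (g (r k) i)) at_top sequentially"
        and s: "strict_mono s"
      then show "convergent (\<lambda>k. g ((r \<circ> s) k) i) \<or> filterlim (\<lambda>k. norm (g ((r \<circ> s) k) i)) at_top sequentially"
        using convergent_subseq_convergent[OF _ s, of "\<lambda>k. g (r k) i"]
          filterlim_compose[OF _ filterlim_subseq[OF s], of "\<lambda>k. norm (g (r k) i)"]
        by (auto simp: o_def)
    qed simp
    then obtain r where r: "strict_mono r" and alt: "\<And>i. i < n \<Longrightarrow> convergent (\<lambda>k. g (r k) i) \<or>
        filterlim (\<lambda>k. norm (g (r k) i)) at_top sequentially"
      by auto
    define J where "J = {i. i < n \<and> convergent (\<lambda>k. g (r k) i)}"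
    define h where "h i = lim (\<lambda>k. g (r k) i)" for i
    have "energy J h \<le> liminf (\<lambda>k. energy {..<n} (g (r k)))"
      using assms(1) alt
      by (intro energy_le_liminf) (auto simp: J_def h_def convergent_LIMSEQ_iff)
    also have "\<dots> = min_energy n"
      using lim_imp_Liminf[OF sequentially_bot LIMSEQ_subseq_LIMSEQ[OF u(2) r]] by (simp add: g(2) o_def)
    finally have le: "energy J h \<le> min_energy n" .
    \<comment> \<open>Not every point can escape: the empty grid admits no weights of sum 1, so its
      energy would be infinite.\<close>
    then have "J \<noteq> {}" using False by (auto simp: energy_empty top_unique)
    then obtain j where j: "j \<in> J" by blast
    \<comment> \<open>Slots of escaped points are refilled with the limit \<open>h j\<close>. The
      tuple still contains all limit points, so the energy does not increase.\<close>
    define \<gamma> where "\<gamma> i = (if i < n then if i \<in> J then h i else h j else undefined)" for i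
    have mem: "\<gamma> \<in> {..<n} \<rightarrow>\<^sub>E UNIV" by (auto simp: \<gamma>_def PiE_def extensional_def)
    have "energy {..<n} \<gamma> \<le> energy J h"
      by (rule energy_image_mono) (auto simp: J_def \<gamma>_def intro!: image_eqI)
    with le have "energy {..<n} \<gamma> \<le> min_energy n" by simp
    moreover have "min_energy n \<le> energy {..<n} \<gamma>"
      unfolding min_energy_def using mem by (intro INF_lower)
    ultimately show ?thesis using that[OF mem] by auto
  qed
qed

lemma dq_opt_eq:
  assumes "p > 1" "n > 0"
  shows "dq_opt N p M X n = ennreal_powr (min_energy n) (1 / p)"
proof -
  obtain \<gamma> where \<gamma>: "\<gamma> \<in> {..<n} \<rightarrow>\<^sub>E UNIV" "energy {..<n} \<gamma> = min_energy n"
    using min_energy_attained[OF assms] by blast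
  have "dq_opt N p M X n \<le> ennreal_powr (min_energy n) (1 / p)"
    unfolding dq_opt_def \<gamma>(2)[symmetric] dq_error_eq[symmetric] using \<gamma>(1) by (rule INF_lower)
  moreover have "ennreal_powr (min_energy n) (1 / p) \<le> dq_opt N p M X n"
    unfolding dq_opt_def dq_error_eq
    using p_pos by (intro INF_greatest ennreal_powr_mono) (auto simp: min_energy_def intro: INF_lower)
  ultimately show ?thesis by simp
qed

lemma dq_error_attains_min:
  assumes "p > 1" "n > 0"
  shows "\<exists>\<gamma> \<in> {..<n} \<rightarrow>\<^sub>E UNIV. \<forall>\<gamma>' \<in> {..<n} \<rightarrow>\<^sub>E UNIV. dq_error N p M X n \<gamma> \<le> dq_error N p M X n \<gamma>'"
proof -
  obtain \<gamma> where \<gamma>: "\<gamma> \<in> {..<n} \<rightarrow>\<^sub>E UNIV" "energy {..<n} \<gamma> = min_energy n"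
    using min_energy_attained[OF assms] by blast
  have "dq_error N p M X n \<gamma> \<le> dq_error N p M X n \<gamma>'" if "\<gamma>' \<in> {..<n} \<rightarrow>\<^sub>E UNIV" for \<gamma>'
    unfolding dq_error_eq \<gamma>(2) using p_pos that
    by (intro ennreal_powr_mono) (auto simp: min_energy_def intro: INF_lower)
  then show ?thesis using \<gamma>(1) by blast
qed

lemma min_energy_grid:
  assumes "p > 1" "n > 0"
  obtains \<Gamma> where "finite \<Gamma>" "card \<Gamma> \<le> n" "grid_energy \<Gamma> = min_energy n"
proof -
  obtain \<gamma> where "energy {..<n} \<gamma> = min_energy n"
    using min_energy_attained[OF assms] by blast
  then show ?thesis
    using that[of "\<gamma> ` {..<n}"] card_image_le[of "{..<n}" \<gamma>] energy_image[of "{..<n}" \<gamma>] by simp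
qed

text \<open>Replaces tuples by finite sets; a set with fewer than \<open>n\<close> points becomes a
  tuple by repeating one of them, which needs the set nonempty.\<close>

lemma optimal_grid_iff:
  assumes "p > 1" "n > 0"
  shows "optimal_grid N p M X n \<Gamma> \<longleftrightarrow>
    finite \<Gamma> \<and> \<Gamma> \<noteq> {} \<and> card \<Gamma> \<le> n \<and> grid_energy \<Gamma> = min_energy n"
proof -
  have eq: "dq_error N p M X n \<gamma> = dq_opt N p M X n \<longleftrightarrow> grid_energy (\<gamma> ` {..<n}) = min_energy n" for \<gamma>
    using p_pos energy_image[of "{..<n}" \<gamma>]
    by (simp add: dq_opt_eq[OF assms] dq_error_eq ennreal_powr_eq_iff)
  show ?thesis
  proof
    assume "optimal_grid N p M X n \<Gamma>"
    then obtain \<gamma> where "\<Gamma> = \<gamma> ` {..<n}" "grid_energy \<Gamma> = min_energy n"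
      unfolding optimal_grid_def eq by blast
    then show "finite \<Gamma> \<and> \<Gamma> \<noteq> {} \<and> card \<Gamma> \<le> n \<and> grid_energy \<Gamma> = min_energy n"
      using assms(2) card_image_le[of "{..<n}" \<gamma>] by auto
  next
    assume "finite \<Gamma> \<and> \<Gamma> \<noteq> {} \<and> card \<Gamma> \<le> n \<and> grid_energy \<Gamma> = min_energy n"
    then show "optimal_grid N p M X n \<Gamma>"
      unfolding optimal_grid_def eq using tuple_with_range[of \<Gamma> n] by metis
  qed
qed

section \<open>Support points missing from a grid\<close>

lemma AE_X_in_supp: "AE \<omega> in M. X \<omega> \<in> measure_supp (distr M borel X)"
  using AE_distrD[OF X_measurable AE_in_measure_supp] by simp

text \<open>Zero energy means that \<open>X\<close> lies almost surely in the grid; a finite set is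
  closed, so it then contains the whole support.\<close>

lemma grid_energy_eq_0_iff:
  assumes "finite \<Gamma>"
  shows "grid_energy \<Gamma> = 0 \<longleftrightarrow> measure_supp (distr M borel X) \<subseteq> \<Gamma>"
proof -
  have "grid_energy \<Gamma> = 0 \<longleftrightarrow> (AE \<omega> in M. X \<omega> \<in> \<Gamma>)"
    unfolding energy_def using assms by (subst nn_integral_0_iff_AE) (auto simp: cost_eq_0_iff)
  also have "\<dots> \<longleftrightarrow> measure_supp (distr M borel X) \<subseteq> \<Gamma>"
    using measure_supp_distr_subset_closed[OF X_measurable _ finite_imp_closed[OF assms]]
      AE_X_in_supp by (auto elim: eventually_mono)
  finally show ?thesis .
qed

text \<open>Near \<open>\<xi>0\<close> the optimal weights \<open>l k\<close> are close to weights \<open>m\<close> representing \<open>\<xi>0\<close>, so half of \<open>m\<close>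
  can be traded for weight \<open>1 / 2\<close> on \<open>\<xi>0\<close> itself; this asymptotically halves the cost.\<close>

lemma grid_energy_insert_less:
  assumes fin: "finite \<Gamma>" "grid_energy \<Gamma> < \<infinity>"
    and x: "\<xi>0 \<in> measure_supp (distr M borel X)" "\<xi>0 \<notin> \<Gamma>"
  shows "grid_energy (insert \<xi>0 \<Gamma>) < grid_energy \<Gamma>"
proof -
  let ?c = "cost N p \<Gamma> (\<lambda>x. x)" and ?c' = "cost N p (insert \<xi>0 \<Gamma>) (\<lambda>x. x)"
  have mono: "?c' \<xi> \<le> ?c \<xi>" for \<xi> using fin by (intro cost_image_mono) auto
  have "\<not> (AE \<omega> in M. ?c (X \<omega>) \<le> ?c' (X \<omega>))"
  proof
    assume "AE \<omega> in M. ?c (X \<omega>) \<le> ?c' (X \<omega>)"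
    moreover have "AE \<omega> in M. ?c (X \<omega>) \<noteq> \<infinity>"
      using fin by (intro nn_integral_PInf_AE) (auto simp: energy_def)
    ultimately have ae: "AE \<omega> in M. ?c (X \<omega>) \<le> ?c' (X \<omega>) \<and> ?c (X \<omega>) \<noteq> \<infinity>" by eventually_elim simp
    \<comment> \<open>Every ball around the support point \<open>\<xi>0\<close> contains a point
      where the insertion does not help and the cost is finite, so that optimal weights exist
      there.\<close>
    have "\<exists>\<xi>\<in>ball \<xi>0 (1 / Suc k). ?c \<xi> \<le> ?c' \<xi> \<and> ?c \<xi> \<noteq> \<infinity>" for k
      by (rule measure_supp_distr_meets[OF X_measurable x(1) ae]) auto
    then obtain xi where xi: "\<And>k. xi k \<in> ball \<xi>0 (1 / Suc k)" "\<And>k. ?c (xi k) \<le> ?c' (xi k)" "\<And>k. ?c (xi k) \<noteq> \<infinity>"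
      by metis
    have lim: "xi \<longlonglongrightarrow> \<xi>0"
    proof (rule LIM_zero_cancel, rule Lim_null_comparison)
      show "\<forall>\<^sub>F k in sequentially. norm (xi k - \<xi>0) \<le> inverse (Suc k)"
        using xi(1) by (intro always_eventually) (auto simp: dist_norm norm_minus_commute less_imp_le inverse_eq_divide)
      show "(\<lambda>k. inverse (real (Suc k))) \<longlonglongrightarrow> 0" by (rule LIMSEQ_inverse_real_of_nat)
    qed
    have "\<exists>l. barycentric \<Gamma> (\<lambda>x. x) (xi k) l \<and> ?c (xi k) = ennreal (moment N p \<Gamma> (\<lambda>x. x) (xi k) l)" for k
      using cost_attained[OF fin(1)] xi(3)[of k] by (metis top.not_eq_extremum infinity_ennreal_def)
    then obtain l where l: "\<And>k. barycentric \<Gamma> (\<lambda>x. x) (xi k) (l k)"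
        "\<And>k. ?c (xi k) = ennreal (moment N p \<Gamma> (\<lambda>x. x) (xi k) (l k))"
      by metis
    have l01: "0 \<le> l k z" "l k z \<le> 1" if "z \<in> \<Gamma>" for z k
      using l(1)[of k] barycentric_le_1[OF fin(1) l(1)[of k]] that by (auto simp: barycentric_def)
    \<comment> \<open>Weights are at most 1 and the distances to the finitely many grid points
      converge, hence the optimal moments are bounded as the limit lemma requires.\<close>
    obtain C where C: "\<And>k. moment N p \<Gamma> (\<lambda>x. x) (xi k) (l k) \<le> C"
    proof -
      have "(\<lambda>k. \<Sum>z\<in>\<Gamma>. N (xi k - z) powr p) \<longlonglongrightarrow> (\<Sum>z\<in>\<Gamma>. N (\<xi>0 - z) powr p)"
        by (intro tendsto_intros lim)
      then obtain C where C: "\<And>k. (\<Sum>z\<in>\<Gamma>. N (xi k - z) powr p) \<le> C"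
        by (rule LIMSEQ_imp_bounded_above) blast
      have "moment N p \<Gamma> (\<lambda>x. x) (xi k) (l k) \<le> C" for k
        using l01 by (intro order_trans[OF _ C[of k]]) (auto simp: moment_def intro!: sum_mono mult_left_le_one_le)
      then show ?thesis using that by blast
    qed
    obtain r m where r: "strict_mono r" and m: "barycentric \<Gamma> (\<lambda>x. x) \<xi>0 m"
      and lm: "\<And>z. z \<in> \<Gamma> \<Longrightarrow> (\<lambda>k. l (r k) z) \<longlonglongrightarrow> m z"
      using barycentric_limit[OF fin(1) subset_refl _ lim tendsto_const _ l(1) C tendsto_const] by blast
    note xir = LIMSEQ_subseq_LIMSEQ[OF lim r, unfolded o_def]
    define v where "v = moment N p \<Gamma> (\<lambda>x. x) \<xi>0 m"
    have "v > 0"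
    proof -
      have "\<exists>z\<in>\<Gamma>. m z \<noteq> 0" using m by (metis barycentric_def sum.neutral zero_neq_one)
      then obtain z where z: "z \<in> \<Gamma>" "m z \<noteq> 0" by blast
      then have "0 < m z * N (\<xi>0 - z) powr p"
        using m x(2) by (auto simp: barycentric_def less_le)
      then show ?thesis unfolding v_def moment_def
        using z m fin(1) by (intro sum_pos2[of _ z]) (auto simp: barycentric_def)
    qed
    \<comment> \<open>Subtracting \<open>m z / 2\<close> removes mass 1/2 and half of
      \<open>\<xi>0\<close> from the barycentre; weight 1/2 on \<open>\<xi>0\<close> restores both
      exactly, and costs only 1/2 * N (xi (r k) - \<xi>0)^p, which vanishes in the limit.\<close>
    define w where "w k z = (if z = \<xi>0 then 1 / 2 else l (r k) z - m z / 2)" for k z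
    have w_sum: "(\<Sum>z\<in>insert \<xi>0 \<Gamma>. f z (w k z)) = f \<xi>0 (1 / 2) + (\<Sum>z\<in>\<Gamma>. f z (l (r k) z - m z / 2))"
      for f :: "_ \<Rightarrow> real \<Rightarrow> 'z::comm_monoid_add" and k
      using fin(1) x(2) by (auto simp: w_def intro!: arg_cong2[of _ _ _ _ "(+)"] sum.cong)
    \<comment> \<open>Needed for \<open>w k\<close> to be nonnegative: trivial where
      \<open>m z\<close> is 0, otherwise the limit \<open>m z\<close> exceeds
      \<open>m z / 2\<close>.\<close>
    have "\<forall>\<^sub>F k in sequentially. \<forall>z\<in>\<Gamma>. m z / 2 \<le> l (r k) z"
      unfolding eventually_ball_finite_distrib[OF fin(1)]
    proof
      fix z assume z: "z \<in> \<Gamma>"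
      show "\<forall>\<^sub>F k in sequentially. m z / 2 \<le> l (r k) z"
      proof (cases "m z = 0")
        case True
        then show ?thesis using l01 z by simp
      next
        case False
        then have "m z / 2 < m z" using m z by (auto simp: barycentric_def less_le)
        from order_tendstoD(1)[OF lm[OF z] this] show ?thesis by eventually_elim simp
      qed
    qed
    \<comment> \<open>At \<open>xi (r k)\<close> the enlarged grid is no cheaper, so the competitor
      \<open>w k\<close> cannot beat the optimal weights \<open>l (r k)\<close>. Passing to the
      limit bounds \<open>v\<close> by \<open>v / 2\<close>.\<close>
    then have le: "\<forall>\<^sub>F k in sequentially. moment N p \<Gamma> (\<lambda>x. x) (xi (r k)) (l (r k)) \<le>
        moment N p (insert \<xi>0 \<Gamma>) (\<lambda>x. x) (xi (r k)) (w k)"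
    proof eventually_elim
      case (elim k)
      have lk: "sum (l (r k)) \<Gamma> = 1" "(\<Sum>z\<in>\<Gamma>. l (r k) z *\<^sub>R z) = xi (r k)"
        using l(1)[of "r k"] by (auto simp: barycentric_def)
      have mk: "sum m \<Gamma> = 1" "(\<Sum>z\<in>\<Gamma>. m z *\<^sub>R z) = \<xi>0" using m by (auto simp: barycentric_def)
      have "(\<Sum>z\<in>\<Gamma>. (m z / 2) *\<^sub>R z) = (1 / 2) *\<^sub>R \<xi>0"
        unfolding mk(2)[symmetric] scaleR_sum_right by simp
      then have "(\<Sum>z\<in>insert \<xi>0 \<Gamma>. w k z *\<^sub>R z) = xi (r k)"
        by (simp add: w_sum[of "\<lambda>z a. a *\<^sub>R z"] scaleR_diff_left sum_subtractf lk)
      moreover have "sum (w k) (insert \<xi>0 \<Gamma>) = 1"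
        by (simp add: w_sum[of "\<lambda>z a. a"] sum_subtractf lk mk flip: sum_divide_distrib)
      ultimately have bary: "barycentric (insert \<xi>0 \<Gamma>) (\<lambda>x. x) (xi (r k)) (w k)"
        using elim by (auto simp: barycentric_def w_def)
      have "ennreal (moment N p \<Gamma> (\<lambda>x. x) (xi (r k)) (l (r k))) \<le>
          ennreal (moment N p (insert \<xi>0 \<Gamma>) (\<lambda>x. x) (xi (r k)) (w k))"
        unfolding l(2)[symmetric] using xi(2) cost_le[OF bary order_refl] by (rule order_trans)
      then show ?case using moment_nonneg[OF bary] by (simp add: ennreal_le_iff)
    qed
    have lim_l: "(\<lambda>k. moment N p \<Gamma> (\<lambda>x. x) (xi (r k)) (l (r k))) \<longlonglongrightarrow> v"
      unfolding v_def moment_def by (intro tendsto_intros lm xir)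
    have lim_w: "(\<lambda>k. moment N p (insert \<xi>0 \<Gamma>) (\<lambda>x. x) (xi (r k)) (w k)) \<longlonglongrightarrow>
        1 / 2 * N (\<xi>0 - \<xi>0) powr p + (\<Sum>z\<in>\<Gamma>. (m z - m z / 2) * N (\<xi>0 - z) powr p)"
      unfolding moment_def w_sum[of "\<lambda>z a. a * N (_ - z) powr p"] by (intro tendsto_intros lm xir) auto
    have "1 / 2 * N (\<xi>0 - \<xi>0) powr p + (\<Sum>z\<in>\<Gamma>. (m z - m z / 2) * N (\<xi>0 - z) powr p) = v / 2"
      by (simp add: v_def moment_def sum_divide_distrib)
    with tendsto_le[OF sequentially_bot lim_w lim_l le] have "v \<le> v / 2" by simp
    then show False using \<open>v > 0\<close> by simp
  qed
  moreover have "grid_energy (insert \<xi>0 \<Gamma>) \<le> grid_energy \<Gamma>"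
    unfolding energy_def by (intro nn_integral_mono mono)
  \<comment> \<open>A strict pointwise gain on a set of positive measure gives a strict inequality
    of integrals only if the smaller one is finite.\<close>
  then have "grid_energy (insert \<xi>0 \<Gamma>) < \<infinity>" using fin(2) by (rule order_le_less_trans)
  then have "(\<integral>\<^sup>+ \<omega>. ?c' (X \<omega>) \<partial>M) \<noteq> \<infinity>" unfolding energy_def by (rule less_imp_neq)
  moreover have "(\<lambda>\<omega>. ?c (X \<omega>)) \<in> borel_measurable M" "(\<lambda>\<omega>. ?c' (X \<omega>)) \<in> borel_measurable M"
    by (intro cost_X_measurable finite.insertI fin(1))+
  ultimately show ?thesis
    unfolding energy_def by (intro nn_integral_less AE_I2 mono)
qed

end

section \<open>Finite and arbitrarily small mean cost\<close>

context dual_quantization_cost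
begin

lemma continuous_on_N_powr: "continuous_on UNIV (\<lambda>x. N x powr p)"
  unfolding continuous_on_def by (intro ballI tendsto_N_powr tendsto_ident_at)

lemma N_powr_diff_bounded:
  assumes "bounded A"
  obtains D where "D > 0" "\<And>x y. x \<in> A \<Longrightarrow> y \<in> A \<Longrightarrow> N (x - y) powr p \<le> D"
proof -
  obtain R where R: "\<And>x. x \<in> A \<Longrightarrow> norm x \<le> R" using assms bounded_iff by metis
  have "compact ((\<lambda>x. N x powr p) ` cball 0 (2 * R))"
    using continuous_on_subset[OF continuous_on_N_powr] by (intro compact_continuous_image) auto
  then obtain D where D: "D > 0" "\<And>z. z \<in> (\<lambda>x. N x powr p) ` cball 0 (2 * R) \<Longrightarrow> norm z \<le> D"
    using compact_imp_bounded bounded_pos by metis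
  have "N (x - y) powr p \<le> D" if "x \<in> A" "y \<in> A" for x y
  proof -
    have "norm (x - y) \<le> 2 * R" using R[OF that(1)] R[OF that(2)] norm_triangle_ineq4[of x y] by linarith
    then have "x - y \<in> cball 0 (2 * R)" by simp
    then show ?thesis using D(2)[OF imageI] by force
  qed
  then show ?thesis using that D(1) by blast
qed

text \<open>Weight 1 - e is placed on \<open>t\<close> and weight e is spread over the grid so as to
  represent \<open>y\<close>. With e = 1 this bounds the cost on the whole convex hull; with small e
  it is an estimate near \<open>t\<close>.\<close>

lemma cost_le_segment:
  assumes fin: "finite \<Gamma>" and t: "t \<in> \<Gamma>" and y: "y \<in> convex hull \<Gamma>" and e: "0 \<le> e" "e \<le> 1"
    and \<xi>: "\<xi> = (1 - e) *\<^sub>R t + e *\<^sub>R y"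
    and D: "\<And>x. x \<in> \<Gamma> \<Longrightarrow> N (\<xi> - x) powr p \<le> D"
  shows "cost N p \<Gamma> (\<lambda>x. x) \<xi> \<le> ennreal ((1 - e) * N (\<xi> - t) powr p + e * D)"
proof -
  obtain u where u: "\<forall>x\<in>\<Gamma>. 0 \<le> u x" "sum u \<Gamma> = 1" "(\<Sum>x\<in>\<Gamma>. u x *\<^sub>R x) = y"
    using y unfolding convex_hull_finite[OF fin] by blast
  define l where "l x = (if x = t then 1 - e else 0) + e * u x" for x
  have "(\<Sum>x\<in>\<Gamma>. (if x = t then 1 - e else 0) *\<^sub>R x) = (\<Sum>x\<in>\<Gamma>. if x = t then (1 - e) *\<^sub>R t else 0)"
    by (intro sum.cong) auto
  then have "(\<Sum>x\<in>\<Gamma>. l x *\<^sub>R x) = (1 - e) *\<^sub>R t + e *\<^sub>R y"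
    using fin t u(3) by (simp add: l_def scaleR_add_left sum.distrib flip: scaleR_scaleR scaleR_sum_right)
  moreover have "sum l \<Gamma> = 1"
    using fin t u(2) by (simp add: l_def sum.distrib flip: sum_distrib_left)
  moreover have "\<forall>x\<in>\<Gamma>. 0 \<le> l x" using e u(1) by (auto simp: l_def)
  ultimately have bary: "barycentric \<Gamma> (\<lambda>x. x) \<xi> l" by (simp add: barycentric_def \<xi>)
  have eq: "(\<Sum>x\<in>\<Gamma>. (if x = t then 1 - e else 0) * N (\<xi> - x) powr p) = (1 - e) * N (\<xi> - t) powr p"
    using fin t by (subst sum.mono_neutral_right[of _ "{t}"]) auto
  have "(\<Sum>x\<in>\<Gamma>. e * u x * N (\<xi> - x) powr p) \<le> (\<Sum>x\<in>\<Gamma>. e * u x * D)"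
    using D u(1) e by (intro sum_mono mult_left_mono) auto
  also have "\<dots> = e * D" using u(2) by (simp flip: sum_distrib_left sum_distrib_right)
  finally have "moment N p \<Gamma> (\<lambda>x. x) \<xi> l \<le> (1 - e) * N (\<xi> - t) powr p + e * D"
    unfolding moment_def l_def distrib_right sum.distrib eq by simp
  with bary show ?thesis by (rule cost_le)
qed

end

context dual_quantization
begin

lemma grid_energy_le:
  assumes "\<And>\<xi>. \<xi> \<in> measure_supp (distr M borel X) \<Longrightarrow> cost N p \<Gamma> (\<lambda>x. x) \<xi> \<le> ennreal c"
  shows "grid_energy \<Gamma> \<le> ennreal c"
proof -
  have "AE \<omega> in M. cost N p \<Gamma> (\<lambda>x. x) (X \<omega>) \<le> ennreal c"
    using AE_X_in_supp by eventually_elim (rule assms)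
  then have "grid_energy \<Gamma> \<le> (\<integral>\<^sup>+ \<omega>. ennreal c \<partial>M)"
    unfolding energy_def by (rule nn_integral_mono_AE)
  then show ?thesis by (simp add: emeasure_space_1)
qed

lemma min_energy_finite:
  assumes "bounded (measure_supp (distr M borel X))" "n \<ge> CARD('d) + 1"
  shows "min_energy n < \<infinity>"
proof -
  let ?S = "measure_supp (distr M borel X)"
  obtain \<Gamma> where \<Gamma>: "finite \<Gamma>" "\<Gamma> \<noteq> {}" "card \<Gamma> \<le> CARD('d) + 1" "?S \<subseteq> convex hull \<Gamma>"
    using bounded_subset_simplex[OF assms(1)] by auto
  obtain D where D: "D > 0" "\<And>x y. x \<in> ?S \<union> \<Gamma> \<Longrightarrow> y \<in> ?S \<union> \<Gamma> \<Longrightarrow> N (x - y) powr p \<le> D"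
    using N_powr_diff_bounded[of "?S \<union> \<Gamma>"] assms(1) \<Gamma>(1) by (auto simp: finite_imp_bounded)
  obtain t where t: "t \<in> \<Gamma>" using \<Gamma>(2) by blast
  have "min_energy n \<le> grid_energy \<Gamma>" using \<Gamma> assms(2) by (intro min_energy_le) auto
  also have "\<dots> \<le> ennreal D"
  proof (rule grid_energy_le)
    fix \<xi> assume "\<xi> \<in> ?S"
    then show "cost N p \<Gamma> (\<lambda>x. x) \<xi> \<le> ennreal D"
      using cost_le_segment[OF \<Gamma>(1) t, of \<xi> 1 \<xi> D] \<Gamma>(4) D(2) by auto
  qed
  also have "\<dots> < \<infinity>" by simp
  finally show ?thesis .
qed

lemma fine_grid:
  assumes S: "compact (measure_supp (distr M borel X))" and c: "c > 0"
  obtains \<Gamma> where "finite \<Gamma>" "grid_energy \<Gamma> \<le> ennreal c"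
proof -
  let ?S = "measure_supp (distr M borel X)"
  obtain R where R: "\<And>x. x \<in> ?S \<Longrightarrow> norm x \<le> R"
    using compact_imp_bounded[OF S] bounded_iff by metis
  \<comment> \<open>The margin 1 leaves room to prolong a segment starting at a support point by
    length up to 1 without leaving the hull.\<close>
  obtain \<Gamma>0 :: "(real ^ 'd) set" where \<Gamma>0: "finite \<Gamma>0" "cball 0 (R + 1) \<subseteq> convex hull \<Gamma>0"
    using bounded_subset_simplex[OF bounded_cball] by metis
  obtain D where D: "D > 0" "\<And>x y. x \<in> ?S \<union> \<Gamma>0 \<Longrightarrow> y \<in> ?S \<union> \<Gamma>0 \<Longrightarrow> N (x - y) powr p \<le> D"
    using N_powr_diff_bounded[of "?S \<union> \<Gamma>0"] compact_imp_bounded[OF S] \<Gamma>0(1)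
    by (auto simp: finite_imp_bounded)
  \<comment> \<open>Chosen so that the far part of the weights costs at most c/2; the minimum with 1
    keeps e a convex coefficient.\<close>
  define e where "e = min 1 (c / (2 * D))"
  have e: "0 < e" "e \<le> 1" "e * D \<le> c / 2"
    using c D(1) mult_right_mono[of e "c / (2 * D)" D] by (auto simp: e_def)
  have "((\<lambda>x. N x powr p) \<longlongrightarrow> N 0 powr p) (at 0)"
    by (intro tendsto_N_powr tendsto_ident_at)
  then have "\<forall>\<^sub>F x in at 0. N x powr p < c / 2"
    using c by (intro order_tendstoD(2)) auto
  then obtain d where d: "d > 0" "\<And>x. x \<noteq> 0 \<Longrightarrow> norm x < d \<Longrightarrow> N x powr p < c / 2"
    by (auto simp: eventually_at)
  \<comment> \<open>Closeness below \<open>d\<close> bounds the cost of the near part by c/2.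
    Closeness below \<open>e\<close> keeps the segment, stretched by 1/e, within length 1.\<close>
  define \<delta> where "\<delta> = min d e"
  have "\<delta> > 0" using d e by (simp add: \<delta>_def)
  then obtain T where T: "T \<subseteq> ?S" "finite T" "?S \<subseteq> (\<Union>t\<in>T. ball t \<delta>)"
    using compactE_image[OF S, of ?S "\<lambda>x. ball x \<delta>"] by force
  have "grid_energy (\<Gamma>0 \<union> T) \<le> ennreal c"
  proof (rule grid_energy_le)
    fix \<xi> assume \<xi>: "\<xi> \<in> ?S"
    then obtain t where t: "t \<in> T" "dist t \<xi> < \<delta>" using T(3) by auto
    define y where "y = t + (1 / e) *\<^sub>R (\<xi> - t)"
    have "norm (\<xi> - t) \<le> e" using t(2) by (simp add: \<delta>_def dist_norm norm_minus_commute)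
    then have "norm ((1 / e) *\<^sub>R (\<xi> - t)) \<le> 1" using e(1) by simp
    moreover have "norm t \<le> R" using R T t by auto
    ultimately have "norm y \<le> R + 1"
      unfolding y_def using norm_triangle_ineq[of t "(1 / e) *\<^sub>R (\<xi> - t)"] by linarith
    then have "y \<in> convex hull (\<Gamma>0 \<union> T)" using \<Gamma>0(2) hull_mono[of \<Gamma>0 "\<Gamma>0 \<union> T" convex] by auto
    moreover have "\<xi> = (1 - e) *\<^sub>R t + e *\<^sub>R y"
      using e(1) by (simp add: y_def algebra_simps)
    ultimately have "cost N p (\<Gamma>0 \<union> T) (\<lambda>x. x) \<xi> \<le> ennreal ((1 - e) * N (\<xi> - t) powr p + e * D)"
      using \<Gamma>0(1) T t(1) e D(2) \<xi> by (intro cost_le_segment) auto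
    also have "\<dots> \<le> ennreal c"
    proof (rule ennreal_leI)
      have "N (\<xi> - t) powr p \<le> c / 2"
        using d(2)[of "\<xi> - t"] t(2) c by (cases "\<xi> = t") (auto simp: \<delta>_def dist_norm norm_minus_commute)
      then have "(1 - e) * N (\<xi> - t) powr p \<le> 1 * (c / 2)"
        using e by (intro mult_mono) auto
      then show "(1 - e) * N (\<xi> - t) powr p + e * D \<le> c" using e(3) by simp
    qed
    finally show "cost N p (\<Gamma>0 \<union> T) (\<lambda>x. x) \<xi> \<le> ennreal c" .
  qed
  then show ?thesis using that[of "\<Gamma>0 \<union> T"] \<Gamma>0(1) T(2) by simp
qed

lemma dq_opt_tendsto_0:
  assumes "p > 1" and S: "compact (measure_supp (distr M borel X))"
  shows "(\<lambda>n. dq_opt N p M X n) \<longlonglongrightarrow> 0"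
proof (rule order_tendstoI)
  fix a :: ennreal assume "0 < a"
  then obtain b where b: "0 < b" "b < a" using dense by blast
  have "b < top" using less_le_trans[OF b(2) top_greatest] .
  with b(1) obtain e where e: "b = ennreal e" "e > 0" by (auto simp: less_top_ennreal)
  obtain \<Gamma> where \<Gamma>: "finite \<Gamma>" "grid_energy \<Gamma> \<le> ennreal (e powr p)"
    using fine_grid[OF S, of "e powr p"] e by auto
  \<comment> \<open>The extra 1 guarantees n > 0, as \<open>dq_opt_eq\<close> demands.\<close>
  have "dq_opt N p M X n < a" if "n \<ge> card \<Gamma> + 1" for n
  proof -
    have "min_energy n \<le> grid_energy \<Gamma>" using \<Gamma>(1) that by (intro min_energy_le) auto
    also have "\<dots> \<le> ennreal_powr b p" using \<Gamma>(2) e by (simp add: ennreal_powr_def)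
    finally have "dq_opt N p M X n \<le> b"
      using that by (simp add: dq_opt_eq[OF assms(1)] ennreal_powr_root_le_iff p_pos)
    then show ?thesis using b(2) by simp
  qed
  then show "\<forall>\<^sub>F n in sequentially. dq_opt N p M X n < a"
    unfolding eventually_sequentially by blast
qed simp

section \<open>Full size of optimal grids and strict decrease\<close>

text \<open>A spare slot and a missed support point together allow an improvement. Level n itself
  gives the exact size of optimal grids; an optimal grid of a lower level gives strict
  decrease.\<close>

lemma min_energy_less_grid_energy:
  assumes "finite \<Gamma>" "grid_energy \<Gamma> < \<infinity>" "\<not> measure_supp (distr M borel X) \<subseteq> \<Gamma>" "card \<Gamma> < n"
  shows "min_energy n < grid_energy \<Gamma>"
proof -
  obtain \<xi> where \<xi>: "\<xi> \<in> measure_supp (distr M borel X)" "\<xi> \<notin> \<Gamma>" using assms(3) by blast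
  have "min_energy n \<le> grid_energy (insert \<xi> \<Gamma>)"
    using assms \<xi>(2) by (intro min_energy_le) auto
  also have "\<dots> < grid_energy \<Gamma>" by (rule grid_energy_insert_less[OF assms(1,2) \<xi>])
  finally show ?thesis .
qed

text \<open>Fewer than \<open>n\<close> points cannot cover a support with at least \<open>n\<close>
  points, so a smaller grid could be improved within level \<open>n\<close>.\<close>

lemma optimal_grid_card:
  assumes "p > 1" "n \<ge> CARD('d) + 1" "bounded (measure_supp (distr M borel X))"
    and "infinite (measure_supp (distr M borel X)) \<or> n \<le> card (measure_supp (distr M borel X))"
    and "optimal_grid N p M X n \<Gamma>"
  shows "finite \<Gamma> \<and> card \<Gamma> = n"
proof -
  have \<Gamma>: "finite \<Gamma>" "card \<Gamma> \<le> n" "grid_energy \<Gamma> = min_energy n"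
    using assms(2,5) optimal_grid_iff[OF assms(1), of n \<Gamma>] by auto
  have "\<not> card \<Gamma> < n"
  proof
    assume less: "card \<Gamma> < n"
    then have "\<not> measure_supp (distr M borel X) \<subseteq> \<Gamma>"
      using assms(4) \<Gamma>(1) card_mono[OF \<Gamma>(1), of "measure_supp (distr M borel X)"]
        finite_subset[OF _ \<Gamma>(1), of "measure_supp (distr M borel X)"] by linarith
    then show False
      using min_energy_less_grid_energy[OF \<Gamma>(1) _ _ less] min_energy_finite[OF assms(3,2)] \<Gamma>(3) by simp
  qed
  then show ?thesis using \<Gamma> by simp
qed

lemma dq_opt_eq_0_iff:
  assumes "p > 1" "n > 0"
  shows "dq_opt N p M X n = 0 \<longleftrightarrow>
    finite (measure_supp (distr M borel X)) \<and> card (measure_supp (distr M borel X)) \<le> n"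
proof -
  obtain \<Gamma> where \<Gamma>: "finite \<Gamma>" "card \<Gamma> \<le> n" "grid_energy \<Gamma> = min_energy n"
    using min_energy_grid[OF assms] by blast
  have "min_energy n = 0" if "finite (measure_supp (distr M borel X))" "card (measure_supp (distr M borel X)) \<le> n"
    using min_energy_le[OF that] grid_energy_eq_0_iff[OF that(1)] by simp
  moreover have "finite (measure_supp (distr M borel X)) \<and> card (measure_supp (distr M borel X)) \<le> n"
    if "min_energy n = 0"
    using that \<Gamma> grid_energy_eq_0_iff[OF \<Gamma>(1)] card_mono[OF \<Gamma>(1)] finite_subset[OF _ \<Gamma>(1)]
    by (metis order_trans)
  ultimately show ?thesis
    by (auto simp: dq_opt_eq[OF assms] ennreal_powr_eq_0_iff)
qed

text \<open>An optimal grid at level \<open>m\<close> has a spare slot at level \<open>n\<close>,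
  and its nonzero energy says that it misses a support point.\<close>

lemma dq_opt_strict_antimono:
  assumes "p > 1" "m \<ge> CARD('d) + 1" "n > m" "bounded (measure_supp (distr M borel X))"
    and "dq_opt N p M X m \<noteq> 0"
  shows "dq_opt N p M X n < dq_opt N p M X m"
proof -
  have pos: "m > 0" "n > 0" using assms(2,3) by auto
  obtain \<Gamma> where \<Gamma>: "finite \<Gamma>" "card \<Gamma> \<le> m" "grid_energy \<Gamma> = min_energy m"
    using min_energy_grid[OF assms(1) pos(1)] by blast
  have "grid_energy \<Gamma> \<noteq> 0"
    using assms(5) by (simp add: dq_opt_eq[OF assms(1) pos(1)] \<Gamma>(3) ennreal_powr_eq_0_iff)
  then have "min_energy n < min_energy m"
    using min_energy_less_grid_energy[OF \<Gamma>(1), of n] min_energy_finite[OF assms(4,2)] \<Gamma> assms(3)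
    by (simp add: grid_energy_eq_0_iff[OF \<Gamma>(1), symmetric])
  then show ?thesis
    using p_pos by (simp add: dq_opt_eq assms(1) pos ennreal_powr_less_iff)
qed

end

theorem theorem5:
  fixes N :: "real ^ 'd \<Rightarrow> real"
    and M :: "'w measure"
    and X :: "'w \<Rightarrow> real ^ 'd"
    and S :: "(real ^ 'd) set"
  assumes "is_norm N"
    and "prob_space M"
    and "X \<in> borel_measurable M"
    and S: "S = measure_supp (distr M borel X)"
    and "compact S"
    and "interior (convex hull S) \<noteq> {}"
  shows
    "(\<forall>p::real. p \<ge> 1 \<longrightarrow> (\<forall>n \<ge> CARD('d) + 1.
        lower_semicontinuous_map (tuple_top n) (dq_error N p M X n) \<and>
        (p > 1 \<longrightarrow> (\<exists>\<gamma> \<in> {..<n} \<rightarrow>\<^sub>E UNIV. \<forall>\<gamma>' \<in> {..<n} \<rightarrow>\<^sub>E UNIV.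
                      dq_error N p M X n \<gamma> \<le> dq_error N p M X n \<gamma>'))))
     \<and>
     (\<forall>p::real. p > 1 \<longrightarrow>
        (\<forall>n \<ge> CARD('d) + 1.
           (infinite S \<or> n \<le> card S \<longrightarrow> (\<forall>\<Gamma>. optimal_grid N p M X n \<Gamma> \<longrightarrow> finite \<Gamma> \<and> card \<Gamma> = n)) \<and>
           (dq_opt N p M X n = 0 \<longleftrightarrow> finite S \<and> card S \<le> n)) \<and>
        (\<forall>m \<ge> CARD('d) + 1. \<forall>n > m. dq_opt N p M X m \<noteq> 0 \<longrightarrow> dq_opt N p M X n < dq_opt N p M X m) \<and>
        (\<lambda>n. dq_opt N p M X n) \<longlonglongrightarrow> 0)"
proof -
  have dq: "dual_quantization N p M X" if "p \<ge> 1" for p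
    unfolding dual_quantization_def dual_quantization_cost_def vector_norm_def
      dual_quantization_cost_axioms_def dual_quantization_axioms_def
    using assms(1-3) that by simp
  have comp: "compact (measure_supp (distr M borel X))"
    and bdd: "bounded (measure_supp (distr M borel X))"
    using assms(5) compact_imp_bounded unfolding S by auto
  have "lower_semicontinuous_map (tuple_top n) (dq_error N p M X n) \<and>
      (p > 1 \<longrightarrow> (\<exists>\<gamma> \<in> {..<n} \<rightarrow>\<^sub>E UNIV. \<forall>\<gamma>' \<in> {..<n} \<rightarrow>\<^sub>E UNIV.
        dq_error N p M X n \<gamma> \<le> dq_error N p M X n \<gamma>'))"
    if "p \<ge> 1" "n \<ge> CARD('d) + 1" for p n
    using dual_quantization.dq_error_lower_semicontinuous[OF dq[OF that(1)]]
      dual_quantization.dq_error_attains_min[OF dq[OF that(1)], of n] that(2) by simp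
  moreover have "(\<forall>n \<ge> CARD('d) + 1.
      (infinite S \<or> n \<le> card S \<longrightarrow> (\<forall>\<Gamma>. optimal_grid N p M X n \<Gamma> \<longrightarrow> finite \<Gamma> \<and> card \<Gamma> = n)) \<and>
      (dq_opt N p M X n = 0 \<longleftrightarrow> finite S \<and> card S \<le> n)) \<and>
      (\<forall>m \<ge> CARD('d) + 1. \<forall>n > m. dq_opt N p M X m \<noteq> 0 \<longrightarrow> dq_opt N p M X n < dq_opt N p M X m) \<and>
      (\<lambda>n. dq_opt N p M X n) \<longlonglongrightarrow> 0"
    if p: "p > 1" for p
  proof -
    interpret dual_quantization N p M X using dq p by simp
    show ?thesis
      unfolding S
    proof (intro conjI allI impI)
      fix n assume "n \<ge> CARD('d) + 1"
      then show "dq_opt N p M X n = 0 \<longleftrightarrow>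
          finite (measure_supp (distr M borel X)) \<and> card (measure_supp (distr M borel X)) \<le> n"
        by (intro dq_opt_eq_0_iff[OF p]) simp
    qed (use optimal_grid_card[OF p _ bdd] dq_opt_strict_antimono[OF p _ _ bdd]
        dq_opt_tendsto_0[OF p comp] in blast)+
  qed
  ultimately show ?thesis by blast
qed

end
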